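(* (ZF, without any form of the axiom of choice.) If $A\subseteq 2^\omega$ is a $G_{\delta\sigma}$ set, then $A$ is countable or $A$ contains a perfect set.
   Context: The background theory is ZF; no form of choice is assumed, not even the countable axiom of choice. A set is countable if it is empty or the image of a map with domain $\omega$. For $s\in 2^{<\omega}$ let $[s]=\{x\in 2^\omega : s\subseteq x\}$; a set $U\subseteq 2^\omega$ is open iff it is a union of sets $[s]$. A set is $G_\delta$ iff it is the intersection of a countable family of open sets, and $G_{\delta\sigma}$ iff it is the union of a countable family of $G_\delta$ sets. A subset $P\subseteq 2^\omega$ is perfect iff it is homeomorphic to $2^\omega$. *)

theory Defs
  imports Main
begin

text \<open>
  HOL has a global choice operator, so a choice-free theorem about HOL sets cannot be stated
  directly.  Instead, the theorem is stated for an arbitrary structure \<open>('a, mem)\<close> that satisfies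
  the first-order axioms of ZF, all set-theoretic notions being those of the structure: each
  quantifier in their definitions ranges over elements of \<open>'a\<close>.  The schemes of separation
  and replacement are restricted to first-order formulas with parameters.  If they were stated for
  all HOL predicates instead, the choice operator of HOL would make the axiom of choice true in
  the structure.
\<close>

datatype fm =
    FMem nat nat
  | FEq nat nat
  | FNeg fm
  | FConj fm fm
  | FEx nat fm

locale membership =
  fixes mem :: "'a \<Rightarrow> 'a \<Rightarrow> bool"  (infix "\<epsilon>" 50)
begin

primrec sat :: "(nat \<Rightarrow> 'a) \<Rightarrow> fm \<Rightarrow> bool" where
  "sat v (FMem i j) \<longleftrightarrow> v i \<epsilon> v j"
| "sat v (FEq i j) \<longleftrightarrow> v i = v j"
| "sat v (FNeg \<phi>) \<longleftrightarrow> \<not> sat v \<phi>"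
| "sat v (FConj \<phi> \<psi>) \<longleftrightarrow> sat v \<phi> \<and> sat v \<psi>"
| "sat v (FEx i \<phi>) \<longleftrightarrow> (\<exists>x. sat (v(i := x)) \<phi>)"

end

text \<open>
  In the two schemes, variable 0 (and variable 1 for the value in replacement) is the bound variable
  of the class or class function; the assignment \<open>v\<close> supplies the parameters.
\<close>

locale ZF = membership +
  assumes extensionality: "\<forall>x y. (\<forall>z. z \<epsilon> x \<longleftrightarrow> z \<epsilon> y) \<longrightarrow> x = y"
    and foundation: "\<forall>x. (\<exists>y. y \<epsilon> x) \<longrightarrow> (\<exists>y. y \<epsilon> x \<and> \<not> (\<exists>z. z \<epsilon> x \<and> z \<epsilon> y))"
    and pairing: "\<forall>x y. \<exists>p. \<forall>z. z \<epsilon> p \<longleftrightarrow> z = x \<or> z = y"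
    and union: "\<forall>F. \<exists>u. \<forall>z. z \<epsilon> u \<longleftrightarrow> (\<exists>y. y \<epsilon> F \<and> z \<epsilon> y)"
    and power_set: "\<forall>x. \<exists>p. \<forall>y. y \<epsilon> p \<longleftrightarrow> (\<forall>z. z \<epsilon> y \<longrightarrow> z \<epsilon> x)"
    and infinity: "\<exists>w. (\<exists>e. e \<epsilon> w \<and> (\<forall>z. \<not> z \<epsilon> e)) \<and>
      (\<forall>x. x \<epsilon> w \<longrightarrow> (\<exists>s. s \<epsilon> w \<and> (\<forall>z. z \<epsilon> s \<longleftrightarrow> z \<epsilon> x \<or> z = x)))"
    and separation: "\<forall>\<phi> v a. \<exists>b. \<forall>x. x \<epsilon> b \<longleftrightarrow> x \<epsilon> a \<and> sat (v(0 := x)) \<phi>"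
    and replacement: "\<forall>\<phi> v a.
      (\<forall>x y z. x \<epsilon> a \<and> sat (v(0 := x, 1 := y)) \<phi> \<and> sat (v(0 := x, 1 := z)) \<phi> \<longrightarrow> y = z) \<longrightarrow>
      (\<exists>b. \<forall>y. y \<epsilon> b \<longleftrightarrow> (\<exists>x. x \<epsilon> a \<and> sat (v(0 := x, 1 := y)) \<phi>))"

context membership
begin

text \<open>
  \<open>set_of P\<close> is the set \<open>{x. P x}\<close> of the structure.  It is only applied below to classes
  \<open>P\<close> for which the axioms of ZF prove that this set exists; it is unique by extensionality.
\<close>

definition set_of :: "('a \<Rightarrow> bool) \<Rightarrow> 'a" where
  "set_of P = (THE a. \<forall>x. x \<epsilon> a \<longleftrightarrow> P x)"

definition subset :: "'a \<Rightarrow> 'a \<Rightarrow> bool" where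
  "subset x y \<longleftrightarrow> (\<forall>z. z \<epsilon> x \<longrightarrow> z \<epsilon> y)"

definition empty :: 'a where
  "empty = set_of (\<lambda>z. False)"

definition inter :: "'a \<Rightarrow> 'a \<Rightarrow> 'a" where
  "inter x y = set_of (\<lambda>z. z \<epsilon> x \<and> z \<epsilon> y)"

definition big_union :: "'a \<Rightarrow> 'a" where
  "big_union F = set_of (\<lambda>z. \<exists>y. y \<epsilon> F \<and> z \<epsilon> y)"

definition upair :: "'a \<Rightarrow> 'a \<Rightarrow> 'a" where
  "upair x y = set_of (\<lambda>z. z = x \<or> z = y)"

definition pair :: "'a \<Rightarrow> 'a \<Rightarrow> 'a" where
  "pair x y = upair (upair x x) (upair x y)"

definition succ :: "'a \<Rightarrow> 'a" where
  "succ x = set_of (\<lambda>z. z \<epsilon> x \<or> z = x)"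

definition two :: 'a where
  "two = succ (succ empty)"

definition is_inductive :: "'a \<Rightarrow> bool" where
  "is_inductive w \<longleftrightarrow> empty \<epsilon> w \<and> (\<forall>x. x \<epsilon> w \<longrightarrow> succ x \<epsilon> w)"

definition omega :: 'a where
  "omega = set_of (\<lambda>n. \<forall>w. is_inductive w \<longrightarrow> n \<epsilon> w)"

definition func :: "'a \<Rightarrow> 'a \<Rightarrow> 'a \<Rightarrow> bool" where
  "func f X Y \<longleftrightarrow>
    (\<forall>p. p \<epsilon> f \<longrightarrow> (\<exists>x y. x \<epsilon> X \<and> y \<epsilon> Y \<and> p = pair x y)) \<and>
    (\<forall>x. x \<epsilon> X \<longrightarrow> (\<exists>!y. pair x y \<epsilon> f))"

definition countable :: "'a \<Rightarrow> bool" where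
  "countable A \<longleftrightarrow> A = empty \<or>
    (\<exists>f. func f omega A \<and> (\<forall>y. y \<epsilon> A \<longrightarrow> (\<exists>n. n \<epsilon> omega \<and> pair n y \<epsilon> f)))"

text \<open>\<open>cantor\<close> is \<open>2\<^sup>\<omega>\<close> and \<open>finseq\<close> is \<open>2\<^bsup><\<omega>\<^esup>\<close>.\<close>

definition cantor :: 'a where
  "cantor = set_of (\<lambda>x. func x omega two)"

definition finseq :: 'a where
  "finseq = set_of (\<lambda>s. \<exists>n. n \<epsilon> omega \<and> func s n two)"

definition cylinder :: "'a \<Rightarrow> 'a" where
  "cylinder s = set_of (\<lambda>x. x \<epsilon> cantor \<and> subset s x)"

definition is_open :: "'a \<Rightarrow> bool" where
  "is_open U \<longleftrightarrow>
    (\<exists>F. (\<forall>B. B \<epsilon> F \<longrightarrow> (\<exists>s. s \<epsilon> finseq \<and> B = cylinder s)) \<and> U = big_union F)"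

text \<open>Intersections are taken inside \<open>2\<^sup>\<omega>\<close>, so that the empty family has intersection \<open>2\<^sup>\<omega>\<close>.\<close>

definition G_delta :: "'a \<Rightarrow> bool" where
  "G_delta G \<longleftrightarrow>
    (\<exists>F. countable F \<and> (\<forall>U. U \<epsilon> F \<longrightarrow> is_open U) \<and>
      G = set_of (\<lambda>x. x \<epsilon> cantor \<and> (\<forall>U. U \<epsilon> F \<longrightarrow> x \<epsilon> U)))"

definition G_delta_sigma :: "'a \<Rightarrow> bool" where
  "G_delta_sigma A \<longleftrightarrow>
    (\<exists>F. countable F \<and> (\<forall>G. G \<epsilon> F \<longrightarrow> G_delta G) \<and> A = big_union F)"

text \<open>The subspace topology on a subset \<open>X\<close> of \<open>2\<^sup>\<omega>\<close>.\<close>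

definition open_in :: "'a \<Rightarrow> 'a \<Rightarrow> bool" where
  "open_in X V \<longleftrightarrow> (\<exists>U. is_open U \<and> V = inter X U)"

definition continuous :: "'a \<Rightarrow> 'a \<Rightarrow> 'a \<Rightarrow> bool" where
  "continuous f X Y \<longleftrightarrow> func f X Y \<and>
    (\<forall>W. open_in Y W \<longrightarrow>
      open_in X (set_of (\<lambda>x. x \<epsilon> X \<and> (\<exists>y. y \<epsilon> W \<and> pair x y \<epsilon> f))))"

definition homeomorphic :: "'a \<Rightarrow> 'a \<Rightarrow> bool" where
  "homeomorphic X Y \<longleftrightarrow>
    (\<exists>f g. continuous f X Y \<and> continuous g Y X \<and> (\<forall>x y. pair x y \<epsilon> f \<longleftrightarrow> pair y x \<epsilon> g))"

definition perfect :: "'a \<Rightarrow> bool" where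
  "perfect P \<longleftrightarrow> subset P cantor \<and> homeomorphic P cantor"

end

end

(* If some member G of the given family of G-delta sets has a nonempty subset K that is dense in
   itself, a Cantor scheme of cylinders that meet K and shrink into the open sets defining G yields
   a perfect subset of G; all choices in the scheme are made by taking the finite sequence with the
   least code.

   Otherwise every G is scattered, and the point is to enumerate the sets G uniformly without
   choosing representations of them as intersections.  This is possible because the
   Cantor-Bendixson derivatives depend on G alone: x is sent to a sequence s such that x is the only
   point of [s] in the last derivative that contains x.  The derivatives are linearly ordered by
   inclusion, so distinct points of G never receive the same s, and the union is covered by the
   values of a partial function on pairs (n, s), which are coded by natural numbers.

   A set of the structure can only be formed by separating with a first-order formula, so
   definability of every class that is used has to be established. *)
theory Submission
  imports Defs
begin

section \<open>Definability with parameters\<close>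

text \<open>Definability is handled semantically: \<open>defP\<close> and \<open>defT\<close> are
  properties of HOL predicates and functions on assignments, closed under connectives, quantifiers
  and substitution, with every set allowed as a parameter. Once the base cases are done, the
  definability of a class is read off its definition by \<open>intro definable\<close>. Recursion
  must also produce definable functions, so it is carried out inside the structure.

  The obstacle for lack of choice sits in the scattered case: in ZF a countable union of countable
  sets may fail to be countable, since enumerations of the members cannot be selected
  simultaneously. In the other case a single \<open>G\<close> is involved, and a sequence of open
  sets for it can be fixed once. There \<open>K\<close> may fail to be closed, and points of the
  perfect set may lie outside \<open>K\<close>: the cylinders meet \<open>K\<close>, while the limit
  points are in \<open>G\<close> because each open set is entered at some level.

  Scatteredness acts pointwise: if x were not isolated in the last derivative S containing it, x
  would lie in the derivative of S. By the choice of S, this derivative would be all of S, so S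
  would be nonempty and dense in itself.\<close>

context membership
begin

primrec vars :: "fm \<Rightarrow> nat set" where
  "vars (FMem i j) = {i, j}"
| "vars (FEq i j) = {i, j}"
| "vars (FNeg \<phi>) = vars \<phi>"
| "vars (FConj \<phi> \<psi>) = vars \<phi> \<union> vars \<psi>"
| "vars (FEx i \<phi>) = insert i (vars \<phi>)"

lemma finite_vars: "finite (vars \<phi>)"
  by (induction \<phi>) auto

lemma sat_cong: "(\<And>i. i \<in> vars \<phi> \<Longrightarrow> v i = w i) \<Longrightarrow> sat v \<phi> \<longleftrightarrow> sat w \<phi>"
proof (induction \<phi> arbitrary: v w)
  case (FEx i \<phi>)
  have "sat (v(i := x)) \<phi> \<longleftrightarrow> sat (w(i := x)) \<phi>" for x
    by (rule FEx.IH) (use FEx.prems in auto)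
  then show ?case by simp
next
  case (FConj \<phi> \<psi>)
  have "sat v \<phi> \<longleftrightarrow> sat w \<phi>" "sat v \<psi> \<longleftrightarrow> sat w \<psi>"
    by (rule FConj.IH, rule FConj.prems, simp)+
  then show ?case by simp
next
  case (FNeg \<phi>)
  have "sat v \<phi> \<longleftrightarrow> sat w \<phi>" by (rule FNeg.IH, rule FNeg.prems, simp)
  then show ?case by simp
qed simp_all

lemma sat_rename: "\<exists>\<psi>. \<forall>v. sat v \<psi> \<longleftrightarrow> sat (\<lambda>n. v (r n)) \<phi>"
proof (induction \<phi> arbitrary: r)
  case (FMem i j)
  show ?case by (rule exI[of _ "FMem (r i) (r j)"]) simp
next
  case (FEq i j)
  show ?case by (rule exI[of _ "FEq (r i) (r j)"]) simp
next
  case (FNeg \<phi>)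
  obtain \<psi> where "\<forall>v. sat v \<psi> \<longleftrightarrow> sat (\<lambda>n. v (r n)) \<phi>" using FNeg[of r] by (elim exE)
  then show ?case by (intro exI[of _ "FNeg \<psi>"]) simp
next
  case (FConj \<phi>1 \<phi>2)
  obtain \<psi>1 where "\<forall>v. sat v \<psi>1 \<longleftrightarrow> sat (\<lambda>n. v (r n)) \<phi>1" using FConj(1)[of r] by (elim exE)
  moreover obtain \<psi>2 where "\<forall>v. sat v \<psi>2 \<longleftrightarrow> sat (\<lambda>n. v (r n)) \<phi>2"
    using FConj(2)[of r] by (elim exE)
  ultimately show ?case by (intro exI[of _ "FConj \<psi>1 \<psi>2"]) simp
next
  case (FEx i \<phi>)
  \<comment> \<open>The bound variable becomes a \<open>k\<close> outside the image of the variables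
    of \<open>\<phi>\<close>, so that the renaming captures nothing.\<close>
  obtain k where k: "k \<notin> r ` vars \<phi>"
    using ex_new_if_finite[OF infinite_UNIV_nat finite_imageI[OF finite_vars]] by blast
  obtain \<psi> where \<psi>: "\<forall>v. sat v \<psi> \<longleftrightarrow> sat (\<lambda>n. v ((r(i := k)) n)) \<phi>" using FEx[of "r(i := k)"] by (elim exE)
  have "sat ((v(k := x))) \<psi> \<longleftrightarrow> sat ((\<lambda>n. v (r n))(i := x)) \<phi>" for v x
    unfolding \<psi>[rule_format] by (rule sat_cong) (use k in auto)
  then show ?case by (intro exI[of _ "FEx k \<psi>"]) simp
qed

text \<open>In an environment each variable of a formula stands for a coordinate of the assignment
  or for a parameter.\<close>

definition env :: "(nat \<Rightarrow> nat + 'a) \<Rightarrow> (nat \<Rightarrow> 'a) \<Rightarrow> nat \<Rightarrow> 'a" where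
  "env e v n = (case e n of Inl k \<Rightarrow> v k | Inr a \<Rightarrow> a)"

definition defP :: "((nat \<Rightarrow> 'a) \<Rightarrow> bool) \<Rightarrow> bool" where
  "defP P \<longleftrightarrow> (\<exists>\<phi> e. \<forall>v. P v \<longleftrightarrow> sat (env e v) \<phi>)"

text \<open>Coordinates are de Bruijn indices: a bound variable is prepended to the assignment.\<close>

definition defT :: "((nat \<Rightarrow> 'a) \<Rightarrow> 'a) \<Rightarrow> bool" where
  "defT t \<longleftrightarrow> defP (\<lambda>v. v 0 = t (\<lambda>n. v (Suc n)))"

lemma defPI: "\<forall>v. P v \<longleftrightarrow> sat (env e v) \<phi> \<Longrightarrow> defP P"
  unfolding defP_def by (rule exI, rule exI)

named_theorems definable

lemma defP_neg [definable]: "defP P \<Longrightarrow> defP (\<lambda>v. \<not> P v)"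
proof -
  assume "defP P"
  then obtain \<phi> e where "\<forall>v. P v \<longleftrightarrow> sat (env e v) \<phi>" unfolding defP_def by (elim exE)
  then have "\<forall>v. \<not> P v \<longleftrightarrow> sat (env e v) (FNeg \<phi>)" by simp
  then show ?thesis by (rule defPI)
qed

lemma defP_conj [definable]:
  assumes "defP P" "defP Q"
  shows "defP (\<lambda>v. P v \<and> Q v)"
proof -
  obtain \<phi> e where 1: "\<forall>v. P v \<longleftrightarrow> sat (env e v) \<phi>" using assms(1) unfolding defP_def by (elim exE)
  obtain \<psi> d where 2: "\<forall>v. Q v \<longleftrightarrow> sat (env d v) \<psi>" using assms(2) unfolding defP_def by (elim exE)
  \<comment> \<open>The two formulas may use one variable for different things; their environments
    are interleaved on the even and the odd variables.\<close>
  define c where "c = (\<lambda>n. if even n then e (n div 2) else d (n div 2))"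
  have c: "env e v = (\<lambda>n. env c v (2 * n))" "env d v = (\<lambda>n. env c v (Suc (2 * n)))" for v
    by (simp_all add: fun_eq_iff env_def c_def)
  obtain \<phi>' where "\<forall>v. sat v \<phi>' \<longleftrightarrow> sat (\<lambda>n. v (2 * n)) \<phi>"
    using sat_rename[of "\<lambda>n. 2 * n" \<phi>] by (elim exE)
  moreover obtain \<psi>' where "\<forall>v. sat v \<psi>' \<longleftrightarrow> sat (\<lambda>n. v (Suc (2 * n))) \<psi>"
    using sat_rename[of "\<lambda>n. Suc (2 * n)" \<psi>] by (elim exE)
  ultimately have "\<forall>v. (P v \<and> Q v) \<longleftrightarrow> sat (env c v) (FConj \<phi>' \<psi>')" using 1 2 c by simp
  then show ?thesis by (rule defPI)
qed

lemma defP_imp [definable]: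
  assumes "defP P" "defP Q"
  shows "defP (\<lambda>v. P v \<longrightarrow> Q v)"
proof -
  have "defP (\<lambda>v. \<not> (P v \<and> \<not> Q v))" by (intro defP_neg defP_conj assms)
  then show ?thesis by (simp only: de_Morgan_conj not_not imp_conv_disj)
qed

lemma defP_disj [definable]:
  assumes "defP P" "defP Q"
  shows "defP (\<lambda>v. P v \<or> Q v)"
proof -
  have "defP (\<lambda>v. \<not> P v \<longrightarrow> Q v)" by (intro defP_neg defP_imp assms)
  then show ?thesis by (simp only: disj_imp)
qed

lemma defP_iff [definable]:
  assumes "defP P" "defP Q"
  shows "defP (\<lambda>v. P v \<longleftrightarrow> Q v)"
proof -
  have "defP (\<lambda>v. (P v \<longrightarrow> Q v) \<and> (Q v \<longrightarrow> P v))" by (intro defP_conj defP_imp assms)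
  then show ?thesis by (simp only: iff_conv_conj_imp)
qed

lemma defP_reindex:
  assumes "defP P"
  shows "defP (\<lambda>v. P (\<lambda>n. v (r n)))"
proof -
  obtain \<phi> e where 1: "\<forall>v. P v \<longleftrightarrow> sat (env e v) \<phi>" using assms unfolding defP_def by (elim exE)
  have "env e (\<lambda>n. v (r n)) = env (\<lambda>n. map_sum r id (e n)) v" for v
    by (auto simp: fun_eq_iff env_def split: sum.split)
  then have "\<forall>v. P (\<lambda>n. v (r n)) \<longleftrightarrow> sat (env (\<lambda>n. map_sum r id (e n)) v) \<phi>"
    using 1 by simp
  then show ?thesis by (rule defPI)
qed

text \<open>Passes from de Bruijn coordinates to a named variable. All variables that
  \<open>e\<close> sends to coordinate 0 are merged into variable 0; the others move up by one to
  keep 0 free, and \<open>d\<close> undoes this shift and lowers the coordinates.\<close>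

lemma env_bind:
  "\<exists>\<psi> d. \<forall>v x. sat (env e (case_nat x v)) \<phi> \<longleftrightarrow> sat ((env d v)(0 := x)) \<psi>"
proof -
  define r where "r = (\<lambda>n. if e n = Inl 0 then 0 else Suc n)"
  define d where "d = (\<lambda>n. case e (n - 1) of Inl k \<Rightarrow> Inl (k - 1) | Inr a \<Rightarrow> Inr a)"
  obtain \<psi> where \<psi>: "\<forall>v. sat v \<psi> \<longleftrightarrow> sat (\<lambda>n. v (r n)) \<phi>"
    using sat_rename[of r \<phi>] by (elim exE)
  have "env e (case_nat x v) = (\<lambda>n. ((env d v)(0 := x)) (r n))" for v x
    by (auto simp: fun_eq_iff env_def r_def d_def split: sum.split nat.split)
  then have "\<forall>v x. sat (env e (case_nat x v)) \<phi> \<longleftrightarrow> sat ((env d v)(0 := x)) \<psi>"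
    using \<psi> by presburger
  then show ?thesis by (intro exI)
qed

lemma defP_ex [definable]:
  assumes "defP (\<lambda>v. R (v 0) (\<lambda>n. v (Suc n)))"
  shows "defP (\<lambda>v. \<exists>x. R x v)"
proof -
  obtain \<phi> e where 1: "\<forall>v. R (v 0) (\<lambda>n. v (Suc n)) \<longleftrightarrow> sat (env e v) \<phi>"
    using assms unfolding defP_def by (elim exE)
  have 2: "R x v \<longleftrightarrow> sat (env e (case_nat x v)) \<phi>" for x v
    using 1[THEN spec, of "case_nat x v"] by (simp only: nat.case)
  obtain \<psi> d where "\<forall>v x. sat (env e (case_nat x v)) \<phi> \<longleftrightarrow> sat ((env d v)(0 := x)) \<psi>"
    using env_bind[of e \<phi>] by (elim exE)
  then have "\<forall>v. (\<exists>x. R x v) \<longleftrightarrow> sat (env d v) (FEx 0 \<psi>)" using 2 by simp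
  then show ?thesis by (rule defPI)
qed

lemma defP_all [definable]:
  assumes "defP (\<lambda>v. R (v 0) (\<lambda>n. v (Suc n)))"
  shows "defP (\<lambda>v. \<forall>x. R x v)"
proof -
  have "defP (\<lambda>v. \<not> (\<exists>x. \<not> R x v))" by (intro defP_neg defP_ex assms)
  then show ?thesis by (simp only: not_ex not_not)
qed

lemma defP_mem_var: "defP (\<lambda>v. v i \<epsilon> v j)"
  unfolding defP_def by (rule exI[of _ "FMem i j"], rule exI[of _ Inl]) (simp add: env_def)

lemma defP_eq_var: "defP (\<lambda>v. v i = v j)"
  unfolding defP_def by (rule exI[of _ "FEq i j"], rule exI[of _ Inl]) (simp add: env_def)

lemma defT_var [definable]: "defT (\<lambda>v. v i)"
  unfolding defT_def by (rule defP_eq_var)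

text \<open>Parameters enter here: an environment may send a variable to any fixed element of the
  structure.\<close>

lemma defT_const [definable]: "defT (\<lambda>v. c)"
  unfolding defT_def defP_def
  by (rule exI[of _ "FEq 0 1"], rule exI[of _ "\<lambda>n. if n = 0 then Inl 0 else Inr c"])
    (simp add: env_def)

section \<open>Substitution of definable terms\<close>

lemma defT_reindex: "defT t \<Longrightarrow> defT (\<lambda>v. t (\<lambda>n. v (r n)))"
  unfolding defT_def using defP_reindex[of "\<lambda>v. v 0 = t (\<lambda>n. v (Suc n))" "case_nat 0 (\<lambda>n. Suc (r n))"]
  by simp

text \<open>The language has no function symbols; a term is eliminated by quantifying over a value
  that satisfies its graph.\<close>

lemma defP_subst:
  assumes "defT t" "defP (\<lambda>v. R (v 0) (\<lambda>n. v (Suc n)))"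
  shows "defP (\<lambda>v. R (t v) v)"
  using defP_ex[of "\<lambda>y v. y = t v \<and> R y v", OF defP_conj[OF assms(1)[unfolded defT_def] assms(2)]]
  by simp

lemma defP_app1:
  assumes "defP (\<lambda>v. R (v 0))" "defT t"
  shows "defP (\<lambda>v. R (t v))"
  by (rule defP_subst[OF assms(2)]) (rule assms(1))

text \<open>Arguments are substituted one at a time, the last one first. The intermediate claims
  hold for all indices and reindexings because every substitution shifts the coordinates of the
  terms already in place.\<close>

lemma defP_app2:
  assumes R: "defP (\<lambda>v. R (v 0) (v 1))" and s: "defT s" and t: "defT t"
  shows "defP (\<lambda>v. R (s v) (t v))"
proof -
  have 1: "defP (\<lambda>v. R (v i) (v j))" for i j
    using defP_reindex[OF R, of "\<lambda>n. if n = 0 then i else j"] by simp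
  have 2: "defP (\<lambda>v. R (v i) (t (\<lambda>n. v (r n))))" for i r
    by (rule defP_subst[of _ "\<lambda>x v. R (v i) x", OF defT_reindex[OF t]]) (rule 1)
  show ?thesis by (rule defP_subst[OF s]) (rule 2)
qed

lemma defP_app3:
  assumes R: "defP (\<lambda>v. R (v 0) (v 1) (v 2))" and s: "defT s" and t: "defT t" and u: "defT u"
  shows "defP (\<lambda>v. R (s v) (t v) (u v))"
proof -
  have 1: "defP (\<lambda>v. R (v i) (v j) (v k))" for i j k
    using defP_reindex[OF R, of "\<lambda>n. if n = 0 then i else if n = 1 then j else k"] by simp
  have 2: "defP (\<lambda>v. R (v i) (v j) (u (\<lambda>n. v (r n))))" for i j r
    by (rule defP_subst[of _ "\<lambda>x v. R (v i) (v j) x", OF defT_reindex[OF u]]) (rule 1)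
  have 3: "defP (\<lambda>v. R (v i) (t (\<lambda>n. v (q n))) (u (\<lambda>n. v (r n))))" for i q r
    by (rule defP_subst[of _ "\<lambda>x v. R (v i) x (u (\<lambda>n. v (r n)))", OF defT_reindex[OF t]]) (rule 2)
  show ?thesis by (rule defP_subst[OF s]) (rule 3)
qed

lemmas defP_mem [definable] = defP_app2[OF defP_mem_var[of 0 1]]
lemmas defP_eq [definable] = defP_app2[OF defP_eq_var[of 0 1]]

lemma defT_app1:
  assumes "defT (\<lambda>v. f (v 0))" "defT s"
  shows "defT (\<lambda>v. f (s v))"
  unfolding defT_def
  by (rule defP_app2[of "\<lambda>x y. x = f y", OF _ defT_var defT_reindex[OF assms(2)]])
    (use assms(1) in \<open>simp add: defT_def\<close>)

lemma defT_app2: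
  assumes "defT (\<lambda>v. f (v 0) (v 1))" "defT s" "defT t"
  shows "defT (\<lambda>v. f (s v) (t v))"
  unfolding defT_def
  by (rule defP_app3[of "\<lambda>x y z. x = f y z", OF _ defT_var defT_reindex[OF assms(2)]
        defT_reindex[OF assms(3)]])
    (use assms(1) in \<open>simp add: defT_def numeral_2_eq_2\<close>)

lemma defP_app4:
  assumes R: "defP (\<lambda>v. R (v 0) (v 1) (v 2) (v 3))"
    and s: "defT s" and t: "defT t" and u: "defT u" and w: "defT w"
  shows "defP (\<lambda>v. R (s v) (t v) (u v) (w v))"
proof -
  have 1: "defP (\<lambda>v. R (v i) (v j) (v k) (v l))" for i j k l
    using defP_reindex[OF R, of "\<lambda>n. if n = 0 then i else if n = 1 then j else if n = 2 then k else l"]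
    by simp
  have 2: "defP (\<lambda>v. R (v i) (v j) (v k) (w (\<lambda>n. v (r n))))" for i j k r
    by (rule defP_subst[of _ "\<lambda>x v. R (v i) (v j) (v k) x", OF defT_reindex[OF w]]) (rule 1)
  have 3: "defP (\<lambda>v. R (v i) (v j) (u (\<lambda>n. v (q n))) (w (\<lambda>n. v (r n))))" for i j q r
    by (rule defP_subst[of _ "\<lambda>x v. R (v i) (v j) x (w (\<lambda>n. v (r n)))", OF defT_reindex[OF u]])
      (rule 2)
  have 4: "defP (\<lambda>v. R (v i) (t (\<lambda>n. v (p n))) (u (\<lambda>n. v (q n))) (w (\<lambda>n. v (r n))))" for i p q r
    by (rule defP_subst[of _ "\<lambda>x v. R (v i) x (u (\<lambda>n. v (q n))) (w (\<lambda>n. v (r n)))",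
        OF defT_reindex[OF t]]) (rule 3)
  show ?thesis by (rule defP_subst[OF s]) (rule 4)
qed

lemma defT_app3:
  assumes "defT (\<lambda>v. f (v 0) (v 1) (v 2))" "defT s" "defT t" "defT u"
  shows "defT (\<lambda>v. f (s v) (t v) (u v))"
  unfolding defT_def
  by (rule defP_app4[of "\<lambda>w x y z. w = f x y z", OF _ defT_var defT_reindex[OF assms(2)]
        defT_reindex[OF assms(3)] defT_reindex[OF assms(4)]])
    (use assms(1) in \<open>simp add: defT_def numeral_2_eq_2 numeral_3_eq_3\<close>)

lemma defT_if [definable]:
  assumes "defP P" "defT s" "defT t"
  shows "defT (\<lambda>v. if P v then s v else t v)"
proof -
  have "defP (\<lambda>v. P (\<lambda>n. v (Suc n)) \<and> v 0 = s (\<lambda>n. v (Suc n)) \<or>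
      \<not> P (\<lambda>n. v (Suc n)) \<and> v 0 = t (\<lambda>n. v (Suc n)))"
    by (intro definable defP_reindex[OF assms(1)] assms(2,3)[unfolded defT_def])
  moreover have "(\<lambda>v. P (\<lambda>n. v (Suc n)) \<and> v 0 = s (\<lambda>n. v (Suc n)) \<or>
      \<not> P (\<lambda>n. v (Suc n)) \<and> v 0 = t (\<lambda>n. v (Suc n))) =
      (\<lambda>v. v 0 = (if P (\<lambda>n. v (Suc n)) then s (\<lambda>n. v (Suc n)) else t (\<lambda>n. v (Suc n))))"
    by (simp add: fun_eq_iff)
  ultimately show ?thesis unfolding defT_def by simp
qed

lemma defP_ex1 [definable]:
  assumes "defP (\<lambda>v. R (v 0) (\<lambda>n. v (Suc n)))"
  shows "defP (\<lambda>v. \<exists>!x. R x v)"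
proof -
  have 1: "defP (\<lambda>v. R (v 0) (\<lambda>n. v (Suc (Suc n))))"
    using defP_reindex[OF assms, of "case_nat 0 (\<lambda>n. Suc (Suc n))"] by simp
  show ?thesis unfolding Ex1_def by (intro definable assms 1)
qed

end

text \<open>If no set has the members given by \<open>P\<close>, then \<open>set_of P\<close> is the fixed junk value
  \<open>THE x. False\<close>, so \<open>set_of\<close> preserves definability without existence conditions.\<close>

lemma (in ZF) defT_set_of [definable]:
  assumes "defP (\<lambda>v. P (v 0) (\<lambda>n. v (Suc n)))"
  shows "defT (\<lambda>v. set_of (\<lambda>x. P x v))"
proof -
  have *: "y = set_of Q \<longleftrightarrow> (\<forall>x. x \<epsilon> y \<longleftrightarrow> Q x) \<or>
      (\<not> (\<exists>a. \<forall>x. x \<epsilon> a \<longleftrightarrow> Q x) \<and> y = (THE x. False))" for y Q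
  proof (cases "\<exists>a. \<forall>x. x \<epsilon> a \<longleftrightarrow> Q x")
    case True
    then obtain a where a: "\<forall>x. x \<epsilon> a \<longleftrightarrow> Q x" by blast
    then have "set_of Q = a" unfolding set_of_def using extensionality by (intro the_equality) auto
    then show ?thesis using a extensionality by metis
  next
    case False
    then have *: "(\<lambda>a. \<forall>x. x \<epsilon> a \<longleftrightarrow> Q x) = (\<lambda>a. False)" by (simp only: fun_eq_iff not_ex simp_thms)
    show ?thesis unfolding set_of_def * using False by blast
  qed
  have 1: "defP (\<lambda>v. P (v 0) (\<lambda>n. v (Suc (Suc n))))"
    using defP_reindex[OF assms, of "case_nat 0 (\<lambda>n. Suc (Suc n))"] by simp
  have 2: "defP (\<lambda>v. P (v 0) (\<lambda>n. v (Suc (Suc (Suc n)))))"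
    using defP_reindex[OF assms, of "case_nat 0 (\<lambda>n. Suc (Suc (Suc n)))"] by simp
  show ?thesis unfolding defT_def * by (intro definable 1 2)
qed

context ZF
begin

lemma separation_definable:
  assumes "defP (\<lambda>v. P (v 0))"
  shows "\<exists>b. \<forall>x. x \<epsilon> b \<longleftrightarrow> x \<epsilon> a \<and> P x"
proof -
  obtain \<phi> e where 1: "\<forall>v. P (v 0) \<longleftrightarrow> sat (env e v) \<phi>" using assms unfolding defP_def by (elim exE)
  obtain \<psi> d where 2: "\<forall>v x. sat (env e (case_nat x v)) \<phi> \<longleftrightarrow> sat ((env d v)(0 := x)) \<psi>"
    using env_bind[of e \<phi>] by (elim exE)
  \<comment> \<open>\<open>P\<close> looks at coordinate 0 alone, so the remaining coordinates can
    be filled with any element; \<open>a\<close> is at hand.\<close>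
  have "P x \<longleftrightarrow> sat ((env d (\<lambda>_. a))(0 := x)) \<psi>" for x
    using 1[THEN spec, of "case_nat x (\<lambda>_. a)"] 2 by (simp only: nat.case)
  then show ?thesis using separation by simp
qed

section \<open>Elementary set theory in the structure\<close>

lemma ext: "(\<And>z. z \<epsilon> x \<longleftrightarrow> z \<epsilon> y) \<Longrightarrow> x = y"
  using extensionality by blast

lemma mem_set_of: "\<exists>a. \<forall>x. x \<epsilon> a \<longleftrightarrow> P x \<Longrightarrow> x \<epsilon> set_of P \<longleftrightarrow> P x"
proof -
  assume "\<exists>a. \<forall>x. x \<epsilon> a \<longleftrightarrow> P x"
  then obtain a where a: "\<forall>x. x \<epsilon> a \<longleftrightarrow> P x" by blast
  then have "set_of P = a" unfolding set_of_def using ext by (intro the_equality) auto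
  then show ?thesis using a by simp
qed

definition Sep :: "'a \<Rightarrow> ('a \<Rightarrow> bool) \<Rightarrow> 'a" where
  "Sep a P = set_of (\<lambda>x. x \<epsilon> a \<and> P x)"

lemma mem_Sep: "defP (\<lambda>v. P (v 0)) \<Longrightarrow> x \<epsilon> Sep a P \<longleftrightarrow> x \<epsilon> a \<and> P x"
  unfolding Sep_def by (rule mem_set_of) (rule separation_definable)

text \<open>The usual way to justify \<open>set_of\<close>: definability together with any set that
  bounds the class.\<close>

lemma mem_set_of_bounded:
  assumes "defP (\<lambda>v. P (v 0))" "\<And>x. P x \<Longrightarrow> x \<epsilon> a"
  shows "x \<epsilon> set_of P \<longleftrightarrow> P x"
  using mem_set_of[of P] separation_definable[OF assms(1), of a] assms(2) by metis

lemma defT_Sep [definable]: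
  assumes "defT a" "defP (\<lambda>v. P (v 0) (\<lambda>n. v (Suc n)))"
  shows "defT (\<lambda>v. Sep (a v) (\<lambda>x. P x v))"
  unfolding Sep_def by (intro definable defT_reindex[OF assms(1)] assms(2))

text \<open>Pattern for all later notions: definability is proved with coordinates as arguments and
  then extended to arbitrary definable terms by an application rule.\<close>

lemma defP_subset_var: "defP (\<lambda>v. subset (v 0) (v 1))"
  unfolding subset_def by (intro definable)
lemmas defP_subset [definable] = defP_app2[of subset, OF defP_subset_var]

lemma defT_upair_var: "defT (\<lambda>v. upair (v 0) (v 1))"
  unfolding upair_def by (intro definable)
lemmas defT_upair [definable] = defT_app2[of upair, OF defT_upair_var]

lemma defT_pair_var: "defT (\<lambda>v. pair (v 0) (v 1))"
  unfolding pair_def by (intro definable)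
lemmas defT_pair [definable] = defT_app2[of pair, OF defT_pair_var]

lemma defT_succ_var: "defT (\<lambda>v. succ (v 0))"
  unfolding succ_def by (intro definable)
lemmas defT_succ [definable] = defT_app1[of succ, OF defT_succ_var]

lemma defP_func_var: "defP (\<lambda>v. func (v 0) (v 1) (v 2))"
  unfolding func_def by (intro definable)
lemmas defP_func [definable] = defP_app3[of func, OF defP_func_var]

lemma mem_empty [simp]: "\<not> x \<epsilon> empty"
  unfolding empty_def using mem_set_of[of "\<lambda>_. False"] infinity by blast

lemma mem_upair [simp]: "z \<epsilon> upair x y \<longleftrightarrow> z = x \<or> z = y"
  unfolding upair_def using pairing by (intro mem_set_of) auto

lemma mem_big_union [simp]: "z \<epsilon> big_union F \<longleftrightarrow> (\<exists>y. y \<epsilon> F \<and> z \<epsilon> y)"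
  unfolding big_union_def using union by (intro mem_set_of) auto

definition pow :: "'a \<Rightarrow> 'a" where
  "pow x = set_of (\<lambda>y. subset y x)"

lemma defT_pow_var: "defT (\<lambda>v. pow (v 0))"
  unfolding pow_def by (intro definable)
lemmas defT_pow [definable] = defT_app1[of pow, OF defT_pow_var]

lemma mem_pow [simp]: "y \<epsilon> pow x \<longleftrightarrow> subset y x"
  unfolding pow_def subset_def using power_set by (intro mem_set_of) auto

lemma mem_inter [simp]: "z \<epsilon> inter x y \<longleftrightarrow> z \<epsilon> x \<and> z \<epsilon> y"
  unfolding inter_def by (intro mem_set_of separation_definable definable)

lemma ex_adjoin: "\<exists>a. \<forall>z. z \<epsilon> a \<longleftrightarrow> z \<epsilon> x \<or> z = y"
  by (rule exI[of _ "big_union (upair x (upair y y))"]) auto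

lemma mem_succ [simp]: "z \<epsilon> succ x \<longleftrightarrow> z \<epsilon> x \<or> z = x"
  unfolding succ_def by (intro mem_set_of ex_adjoin)

lemma upair_eq: "upair a b = upair c d \<longleftrightarrow> a = c \<and> b = d \<or> a = d \<and> b = c"
proof
  assume "upair a b = upair c d"
  then have "z = a \<or> z = b \<longleftrightarrow> z = c \<or> z = d" for z using mem_upair by metis
  then show "a = c \<and> b = d \<or> a = d \<and> b = c" by metis
next
  show "a = c \<and> b = d \<or> a = d \<and> b = c \<Longrightarrow> upair a b = upair c d" by (auto intro: ext)
qed

lemma pair_eq [simp]: "pair a b = pair c d \<longleftrightarrow> a = c \<and> b = d"
  unfolding pair_def upair_eq by auto

definition prod :: "'a \<Rightarrow> 'a \<Rightarrow> 'a" where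
  "prod X Y = set_of (\<lambda>p. \<exists>x y. x \<epsilon> X \<and> y \<epsilon> Y \<and> p = pair x y)"

lemma defT_prod_var: "defT (\<lambda>v. prod (v 0) (v 1))"
  unfolding prod_def by (intro definable)
lemmas defT_prod [definable] = defT_app2[of prod, OF defT_prod_var]

lemma mem_prod: "p \<epsilon> prod X Y \<longleftrightarrow> (\<exists>x y. x \<epsilon> X \<and> y \<epsilon> Y \<and> p = pair x y)"
  unfolding prod_def
proof (rule mem_set_of_bounded)
  show "defP (\<lambda>v. \<exists>x y. x \<epsilon> X \<and> y \<epsilon> Y \<and> v 0 = pair x y)" by (intro definable)
  \<comment> \<open>A Kuratowski pair is a set of subsets of the union of \<open>X\<close> and
    \<open>Y\<close>, which places it two power sets above that union.\<close>
  show "p \<epsilon> pow (pow (big_union (upair X Y)))"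
    if p: "\<exists>x y. x \<epsilon> X \<and> y \<epsilon> Y \<and> p = pair x y" for p
  proof -
    obtain x y where xy: "x \<epsilon> X" "y \<epsilon> Y" "p = pair x y" using p by blast
    then have "x \<epsilon> big_union (upair X Y)" "y \<epsilon> big_union (upair X Y)"
      unfolding mem_big_union mem_upair by blast+
    then show ?thesis unfolding xy(3) by (simp add: pair_def subset_def)
  qed
qed

lemma pair_mem_prod [simp]: "pair x y \<epsilon> prod X Y \<longleftrightarrow> x \<epsilon> X \<and> y \<epsilon> Y"
  by (auto simp: mem_prod)

text \<open>A two-element membership cycle would be a pair without a minimal element, against
  foundation.\<close>

lemma mem_asym: "x \<epsilon> y \<Longrightarrow> \<not> y \<epsilon> x"
  using foundation[rule_format, of "upair x y"] by auto

lemma mem_irrefl [simp]: "\<not> x \<epsilon> x"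
  using mem_asym by blast

lemma succ_inj [simp]: "succ x = succ y \<longleftrightarrow> x = y"
  using mem_succ mem_asym by metis

lemma succ_neq_empty [simp]: "succ x \<noteq> empty" "empty \<noteq> succ x"
  using mem_succ[of x x] by (metis mem_empty)+

lemma subsetI: "(\<And>z. z \<epsilon> x \<Longrightarrow> z \<epsilon> y) \<Longrightarrow> subset x y"
  by (simp add: subset_def)

lemma subsetD: "subset x y \<Longrightarrow> z \<epsilon> x \<Longrightarrow> z \<epsilon> y"
  by (simp add: subset_def)

lemma subset_refl [simp]: "subset x x"
  by (simp add: subset_def)

lemma subset_trans: "subset x y \<Longrightarrow> subset y z \<Longrightarrow> subset x z"
  by (simp add: subset_def)

lemma subset_antisym: "subset x y \<Longrightarrow> subset y x \<Longrightarrow> x = y"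
  by (rule ext) (auto simp: subset_def)

lemma empty_subset [simp]: "subset empty x"
  by (simp add: subset_def)

section \<open>The natural numbers\<close>

lemma mem_omega: "n \<epsilon> omega \<longleftrightarrow> (\<forall>w. is_inductive w \<longrightarrow> n \<epsilon> w)"
proof -
  obtain w e where "e \<epsilon> w" "\<forall>z. \<not> z \<epsilon> e"
    "\<forall>x. x \<epsilon> w \<longrightarrow> (\<exists>s. s \<epsilon> w \<and> (\<forall>z. z \<epsilon> s \<longleftrightarrow> z \<epsilon> x \<or> z = x))"
    using infinity by blast
  then have "is_inductive w"
    unfolding is_inductive_def by (metis ext mem_empty mem_succ)
  moreover have "defP (\<lambda>v. \<forall>w. is_inductive w \<longrightarrow> v 0 \<epsilon> w)"
    unfolding is_inductive_def by (intro definable)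
  ultimately show ?thesis
    unfolding omega_def by (intro mem_set_of_bounded[where a = w]) auto
qed

lemma empty_omega [simp]: "empty \<epsilon> omega"
  by (simp add: mem_omega is_inductive_def)

lemma succ_omega [simp]: "n \<epsilon> omega \<Longrightarrow> succ n \<epsilon> omega"
  by (simp add: mem_omega is_inductive_def)

text \<open>Induction compares \<open>omega\<close> with the set of numbers satisfying
  \<open>P\<close>. That set must exist in the structure, hence the additional case
  \<open>def\<close>.\<close>

lemma omega_induct [consumes 1, case_names def empty succ]:
  assumes "n \<epsilon> omega" "defP (\<lambda>v. P (v 0))" "P empty"
    "\<And>n. n \<epsilon> omega \<Longrightarrow> P n \<Longrightarrow> P (succ n)"
  shows "P n"
proof -
  have "is_inductive (Sep omega P)"
    unfolding is_inductive_def mem_Sep[OF assms(2)] using assms by simp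
  then show ?thesis using assms(1) mem_omega mem_Sep[OF assms(2)] by blast
qed

lemma omega_cases: "n \<epsilon> omega \<Longrightarrow> n = empty \<or> (\<exists>m. m \<epsilon> omega \<and> n = succ m)"
proof (induction n rule: omega_induct)
  case def
  show ?case by (intro definable)
qed auto

lemma omega_mem_trans: "n \<epsilon> omega \<Longrightarrow> m \<epsilon> n \<Longrightarrow> k \<epsilon> m \<Longrightarrow> k \<epsilon> n"
proof -
  have "n \<epsilon> omega \<Longrightarrow> \<forall>m. m \<epsilon> n \<longrightarrow> (\<forall>k. k \<epsilon> m \<longrightarrow> k \<epsilon> n)"
  proof (induction n rule: omega_induct)
    case def
    show ?case by (intro definable)
  qed auto
  then show "n \<epsilon> omega \<Longrightarrow> m \<epsilon> n \<Longrightarrow> k \<epsilon> m \<Longrightarrow> k \<epsilon> n" by blast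
qed

lemma mem_omega_omega: "n \<epsilon> omega \<Longrightarrow> m \<epsilon> n \<Longrightarrow> m \<epsilon> omega"
proof -
  have "n \<epsilon> omega \<Longrightarrow> \<forall>m. m \<epsilon> n \<longrightarrow> m \<epsilon> omega"
  proof (induction n rule: omega_induct)
    case def
    show ?case by (intro definable)
  qed auto
  then show "n \<epsilon> omega \<Longrightarrow> m \<epsilon> n \<Longrightarrow> m \<epsilon> omega" by blast
qed

lemma omega_linear: "n \<epsilon> omega \<Longrightarrow> m \<epsilon> omega \<Longrightarrow> m \<epsilon> n \<or> m = n \<or> n \<epsilon> m"
proof -
  have succ_mono: "n \<epsilon> omega \<Longrightarrow> \<forall>m. m \<epsilon> n \<longrightarrow> succ m \<epsilon> succ n" for n
  proof (induction n rule: omega_induct)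
    case def
    show ?case by (intro definable)
  qed auto
  have "n \<epsilon> omega \<Longrightarrow> \<forall>m. m \<epsilon> omega \<longrightarrow> m \<epsilon> n \<or> m = n \<or> n \<epsilon> m"
  proof (induction n rule: omega_induct)
    case def
    show ?case by (intro definable)
  next
    case empty
    have "m \<epsilon> omega \<Longrightarrow> m = empty \<or> empty \<epsilon> m" for m
    proof (induction m rule: omega_induct)
      case def
      show ?case by (intro definable)
    qed auto
    then show ?case by blast
  next
    case (succ n)
    then show ?case using succ_mono omega_cases by (metis mem_succ)
  qed
  then show "n \<epsilon> omega \<Longrightarrow> m \<epsilon> omega \<Longrightarrow> m \<epsilon> n \<or> m = n \<or> n \<epsilon> m" by blast
qed

lemma omega_linear_subset:
  "n \<epsilon> omega \<Longrightarrow> m \<epsilon> omega \<Longrightarrow> subset n m \<or> subset m n"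
  using omega_linear omega_mem_trans unfolding subset_def by metis

text \<open>Foundation gives a membership-minimal element, and membership is the order of
  \<open>omega\<close>.\<close>

lemma omega_least:
  assumes "defP (\<lambda>v. P (v 0))" "n \<epsilon> omega" "P n"
  obtains m where "m \<epsilon> omega" "P m" "\<And>k. k \<epsilon> m \<Longrightarrow> \<not> P k"
proof -
  have "n \<epsilon> Sep omega P" using assms mem_Sep by blast
  then obtain m where "m \<epsilon> Sep omega P" "\<not> (\<exists>z. z \<epsilon> Sep omega P \<and> z \<epsilon> m)"
    using foundation by meson
  then show thesis using that mem_Sep[OF assms(1)] mem_omega_omega by metis
qed

lemma mem_two [simp]: "i \<epsilon> two \<longleftrightarrow> i = empty \<or> i = succ empty"
  by (auto simp: two_def)

section \<open>Binary sequences\<close>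

text \<open>\<open>seq s n\<close> covers both finite sequences of length \<open>n\<close> and, for \<open>n = omega\<close>, the points
  of the Cantor space.\<close>

abbreviation seq :: "'a \<Rightarrow> 'a \<Rightarrow> bool" where
  "seq s n \<equiv> func s n two"

lemma mem_cantor [simp]: "x \<epsilon> cantor \<longleftrightarrow> seq x omega"
  unfolding cantor_def
proof (rule mem_set_of_bounded[where a = "pow (prod omega two)"])
  show "defP (\<lambda>v. seq (v 0) omega)" by (intro definable)
qed (auto simp: func_def subset_def mem_prod)

lemma mem_finseq: "s \<epsilon> finseq \<longleftrightarrow> (\<exists>n. n \<epsilon> omega \<and> seq s n)"
  unfolding finseq_def
proof (rule mem_set_of_bounded[where a = "pow (prod omega two)"])
  show "defP (\<lambda>v. \<exists>n. n \<epsilon> omega \<and> seq (v 0) n)" by (intro definable)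
  show "s \<epsilon> pow (prod omega two)" if "\<exists>n. n \<epsilon> omega \<and> seq s n" for s
    using that mem_omega_omega unfolding func_def mem_pow subset_def mem_prod by blast
qed

definition dom :: "'a \<Rightarrow> 'a" where
  "dom s = set_of (\<lambda>k. \<exists>i. pair k i \<epsilon> s)"

lemma defT_dom_var: "defT (\<lambda>v. dom (v 0))"
  unfolding dom_def by (intro definable)
lemmas defT_dom [definable] = defT_app1[of dom, OF defT_dom_var]

lemma dom_eq: "func s n Y \<Longrightarrow> dom s = n"
proof -
  assume s: "func s n Y"
  then have *: "\<forall>k. k \<epsilon> n \<longleftrightarrow> (\<exists>i. pair k i \<epsilon> s)" unfolding func_def using pair_eq by metis
  then have "k \<epsilon> dom s \<longleftrightarrow> (\<exists>i. pair k i \<epsilon> s)" for k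
    unfolding dom_def by (intro mem_set_of exI)
  then show ?thesis using * by (intro ext) simp
qed

lemma finseq_seq: "s \<epsilon> finseq \<Longrightarrow> seq s (dom s)"
  using mem_finseq dom_eq by metis

lemma finseq_dom: "s \<epsilon> finseq \<Longrightarrow> dom s \<epsilon> omega"
  using mem_finseq dom_eq by metis

lemma seq_unique: "func s n Y \<Longrightarrow> pair k i \<epsilon> s \<Longrightarrow> pair k j \<epsilon> s \<Longrightarrow> i = j"
  unfolding func_def using pair_eq by metis

lemma seq_total: "func s n Y \<Longrightarrow> k \<epsilon> n \<Longrightarrow> \<exists>i. i \<epsilon> Y \<and> pair k i \<epsilon> s"
  unfolding func_def using pair_eq by metis

lemma seq_pairD: "func s n Y \<Longrightarrow> pair k i \<epsilon> s \<Longrightarrow> k \<epsilon> n \<and> i \<epsilon> Y"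
  unfolding func_def using pair_eq by metis

lemma seq_pairE:
  assumes "func s n Y" "p \<epsilon> s"
  obtains k i where "k \<epsilon> n" "i \<epsilon> Y" "p = pair k i"
  using assms unfolding func_def by blast

lemma seqI:
  assumes "\<And>p. p \<epsilon> s \<Longrightarrow> \<exists>k i. k \<epsilon> n \<and> i \<epsilon> Y \<and> p = pair k i"
    "\<And>k. k \<epsilon> n \<Longrightarrow> \<exists>i. pair k i \<epsilon> s"
    "\<And>k i j. pair k i \<epsilon> s \<Longrightarrow> pair k j \<epsilon> s \<Longrightarrow> i = j"
  shows "func s n Y"
  unfolding func_def using assms by metis

lemma seq_ext:
  assumes "func x n Y" "func y n Z" "\<And>k i. pair k i \<epsilon> x \<Longrightarrow> pair k i \<epsilon> y"
  shows "x = y"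
proof (rule ext)
  fix p
  show "p \<epsilon> x \<longleftrightarrow> p \<epsilon> y"
  proof
    assume "p \<epsilon> x"
    then show "p \<epsilon> y" using assms by (metis seq_pairE)
  next
    assume "p \<epsilon> y"
    then obtain k i where p: "k \<epsilon> n" "p = pair k i" using assms(2) by (metis seq_pairE)
    then obtain j where "pair k j \<epsilon> x" using assms(1) seq_total by metis
    then show "p \<epsilon> x" using p \<open>p \<epsilon> y\<close> assms seq_unique by metis
  qed
qed

lemma seq_subset_eq: "func x n Y \<Longrightarrow> func y n Z \<Longrightarrow> subset x y \<Longrightarrow> x = y"
  using seq_ext subsetD by metis

lemma seq_subset_dom: "func s n Y \<Longrightarrow> func t m Z \<Longrightarrow> subset s t \<Longrightarrow> subset n m"
  using seq_total seq_pairD unfolding subset_def by metis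

text \<open>Both are parts of the single-valued \<open>x\<close>, so they agree wherever both are
  defined; the inclusion of domains does the rest.\<close>

lemma seq_subset_chain:
  assumes "func s n Y" "func t m Z" "func x l W" "subset s x" "subset t x" "subset n m"
  shows "subset s t"
proof (rule subsetI)
  fix p assume "p \<epsilon> s"
  then obtain k i where p: "k \<epsilon> n" "p = pair k i" using assms(1) by (metis seq_pairE)
  then obtain j where j: "pair k j \<epsilon> t" using assms seq_total subsetD by metis
  then have "i = j" using p \<open>p \<epsilon> s\<close> assms seq_unique subsetD by metis
  then show "p \<epsilon> t" using j p by simp
qed

lemma seq_empty [simp]: "seq empty empty"
  by (simp add: func_def)

lemma empty_finseq [simp]: "empty \<epsilon> finseq"
  using mem_finseq seq_empty empty_omega by blast

lemma dom_empty [simp]: "dom empty = empty"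
  using dom_eq seq_empty by blast

definition snoc :: "'a \<Rightarrow> 'a \<Rightarrow> 'a" where
  "snoc s i = set_of (\<lambda>p. p \<epsilon> s \<or> p = pair (dom s) i)"

lemma defT_snoc_var: "defT (\<lambda>v. snoc (v 0) (v 1))"
  unfolding snoc_def by (intro definable)
lemmas defT_snoc [definable] = defT_app2[of snoc, OF defT_snoc_var]

lemma mem_snoc [simp]: "p \<epsilon> snoc s i \<longleftrightarrow> p \<epsilon> s \<or> p = pair (dom s) i"
  unfolding snoc_def by (intro mem_set_of ex_adjoin)

lemma snoc_superset [simp]: "subset s (snoc s i)"
  by (simp add: subset_def)

lemma seq_snoc:
  assumes "seq s n" "i \<epsilon> two"
  shows "seq (snoc s i) (succ n)"
proof (rule seqI)
  have d: "dom s = n" using assms dom_eq by blast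
  show "\<exists>k i. k \<epsilon> succ n \<and> i \<epsilon> two \<and> p = pair k i" if "p \<epsilon> snoc s i" for p
    using that d assms by (metis mem_snoc mem_succ seq_pairE)
  show "\<exists>j. pair k j \<epsilon> snoc s i" if "k \<epsilon> succ n" for k
    using that d assms by (metis mem_snoc mem_succ seq_total)
  show "j = l" if "pair k j \<epsilon> snoc s i" "pair k l \<epsilon> snoc s i" for k j l
    using that d assms by (metis mem_snoc mem_irrefl seq_unique seq_pairD pair_eq)
qed

lemma snoc_finseq [simp]: "s \<epsilon> finseq \<Longrightarrow> i \<epsilon> two \<Longrightarrow> snoc s i \<epsilon> finseq"
  using seq_snoc mem_finseq succ_omega by metis

lemma dom_snoc [simp]: "s \<epsilon> finseq \<Longrightarrow> i \<epsilon> two \<Longrightarrow> dom (snoc s i) = succ (dom s)"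
  using seq_snoc finseq_seq dom_eq by metis

lemma snoc_neq_empty [simp]: "snoc s i \<noteq> empty" "empty \<noteq> snoc s i"
  using mem_snoc[of "pair (dom s) i" s i] by (metis mem_empty)+

lemma snoc_inj:
  assumes "s \<epsilon> finseq" "t \<epsilon> finseq" "i \<epsilon> two" "j \<epsilon> two" "snoc s i = snoc t j"
  shows "s = t \<and> i = j"
proof -
  have d: "dom s = dom t" using assms dom_snoc succ_inj by metis
  \<comment> \<open>Neither sequence is defined at its own length, so the appended pair can be told
    apart from the old ones.\<close>
  have new: "\<not> pair (dom t) k \<epsilon> s" "\<not> pair (dom t) k \<epsilon> t" for k
    using finseq_seq[OF assms(1)] finseq_seq[OF assms(2)] seq_pairD mem_irrefl d by metis+
  have eq: "p \<epsilon> s \<or> p = pair (dom t) i \<longleftrightarrow> p \<epsilon> t \<or> p = pair (dom t) j" for p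
    using assms(5) d mem_snoc by metis
  have "i = j" using eq[of "pair (dom t) i"] new by simp
  moreover have "s = t" using eq new \<open>i = j\<close> by (intro ext) metis
  ultimately show ?thesis by simp
qed

section \<open>Initial segments and induction on finite sequences\<close>

definition restrict :: "'a \<Rightarrow> 'a \<Rightarrow> 'a" where
  "restrict x n = Sep x (\<lambda>p. \<exists>k i. k \<epsilon> n \<and> p = pair k i)"

lemma defT_restrict_var: "defT (\<lambda>v. restrict (v 0) (v 1))"
  unfolding restrict_def by (intro definable)
lemmas defT_restrict [definable] = defT_app2[of restrict, OF defT_restrict_var]

lemma mem_restrict: "p \<epsilon> restrict x n \<longleftrightarrow> p \<epsilon> x \<and> (\<exists>k i. k \<epsilon> n \<and> p = pair k i)"
  unfolding restrict_def by (rule mem_Sep) (intro definable)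

lemma pair_mem_restrict [simp]: "pair k i \<epsilon> restrict x n \<longleftrightarrow> pair k i \<epsilon> x \<and> k \<epsilon> n"
  by (auto simp: mem_restrict)

lemma restrict_subset [simp]: "subset (restrict x n) x"
  by (simp add: subset_def mem_restrict)

lemma seq_restrict:
  assumes "func x m Y" "subset n m"
  shows "func (restrict x n) n Y"
proof (rule seqI)
  show "\<exists>k i. k \<epsilon> n \<and> i \<epsilon> Y \<and> p = pair k i" if "p \<epsilon> restrict x n" for p
    using that assms seq_pairD unfolding mem_restrict by metis
  show "\<exists>i. pair k i \<epsilon> restrict x n" if "k \<epsilon> n" for k
    using that assms seq_total subsetD unfolding pair_mem_restrict by metis
  show "i = j" if "pair k i \<epsilon> restrict x n" "pair k j \<epsilon> restrict x n" for k i j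
    using that assms seq_unique unfolding pair_mem_restrict by metis
qed

lemma omega_subset: "n \<epsilon> omega \<Longrightarrow> subset n omega"
  using mem_omega_omega subset_def by blast

lemma restrict_finseq: "x \<epsilon> cantor \<Longrightarrow> n \<epsilon> omega \<Longrightarrow> restrict x n \<epsilon> finseq"
  unfolding mem_cantor mem_finseq
  by (rule exI, rule conjI, assumption, rule seq_restrict, assumption, rule omega_subset)

lemma dom_restrict: "x \<epsilon> cantor \<Longrightarrow> n \<epsilon> omega \<Longrightarrow> dom (restrict x n) = n"
  unfolding mem_cantor by (rule dom_eq, rule seq_restrict, assumption, rule omega_subset)

lemma restrict_eq:
  assumes "t \<epsilon> finseq" "x \<epsilon> cantor" "subset t x"
  shows "restrict x (dom t) = t"
proof (rule sym, rule seq_ext)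
  show "seq t (dom t)" using assms finseq_seq by blast
  show "seq (restrict x (dom t)) (dom t)"
    using restrict_finseq[OF assms(2) finseq_dom[OF assms(1)]] finseq_seq
      dom_restrict[OF assms(2) finseq_dom[OF assms(1)]] by metis
  show "pair k i \<epsilon> restrict x (dom t)" if "pair k i \<epsilon> t" for k i
    using that assms finseq_seq seq_pairD subsetD by simp metis
qed

lemma seq_succE:
  assumes "seq s (succ n)" "n \<epsilon> omega"
  obtains t i where "seq t n" "i \<epsilon> two" "s = snoc t i"
proof -
  have t: "seq (restrict s n) n" by (rule seq_restrict[OF assms(1)]) (simp add: subset_def)
  obtain i where i: "i \<epsilon> two" "pair n i \<epsilon> s" using assms seq_total by (metis mem_succ)
  have "snoc (restrict s n) i = s"
    by (rule seq_ext[OF seq_snoc[OF t i(1)] assms(1)]) (use i in \<open>auto simp: dom_eq[OF t]\<close>)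
  then show thesis using that t i by metis
qed

lemma finseq_induct [consumes 1, case_names def empty snoc]:
  assumes "s \<epsilon> finseq" "defP (\<lambda>v. P (v 0))" "P empty"
    "\<And>s i. s \<epsilon> finseq \<Longrightarrow> i \<epsilon> two \<Longrightarrow> P s \<Longrightarrow> P (snoc s i)"
  shows "P s"
proof -
  have "n \<epsilon> omega \<Longrightarrow> \<forall>s. seq s n \<longrightarrow> P s" for n
  proof (induction n rule: omega_induct)
    case def
    show ?case by (intro definable defP_app1[OF assms(2)])
  next
    case empty
    have "seq s empty \<Longrightarrow> s = empty" for s using seq_pairE by (metis ext mem_empty)
    then show ?case using assms(3) by blast
  next
    case (succ n)
    then show ?case using seq_succE assms(4) mem_finseq by metis
  qed
  then show ?thesis using assms(1) mem_finseq by blast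
qed

lemma finseq_cases:
  "s \<epsilon> finseq \<Longrightarrow> s = empty \<or> (\<exists>t i. t \<epsilon> finseq \<and> i \<epsilon> two \<and> s = snoc t i)"
proof (induction s rule: finseq_induct)
  case def
  show ?case by (intro definable)
qed auto

text \<open>Compare lengths: \<open>s\<close> is at most as long as \<open>t\<close> and then lies
  inside it, or it has the full length of \<open>snoc t i\<close>.\<close>

lemma subset_snoc:
  assumes "s \<epsilon> finseq" "t \<epsilon> finseq" "i \<epsilon> two" "subset s (snoc t i)"
  shows "s = snoc t i \<or> subset s t"
proof (cases "subset (dom s) (dom t)")
  case True
  then show ?thesis using seq_subset_chain[of s "dom s" two t "dom t" two "snoc t i"] assms finseq_seq
      snoc_finseq snoc_superset by metis
next
  case False
  have "subset (dom s) (succ (dom t))"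
    using seq_subset_dom assms finseq_seq snoc_finseq dom_snoc by metis
  then have "dom t \<epsilon> dom s" using False unfolding subset_def by (metis mem_succ)
  then have "subset (succ (dom t)) (dom s)"
    using omega_mem_trans[OF finseq_dom[OF assms(1)]] unfolding subset_def by (metis mem_succ)
  then have "dom s = succ (dom t)"
    using \<open>subset (dom s) (succ (dom t))\<close> subset_antisym by blast
  then show ?thesis using seq_subset_eq assms finseq_seq snoc_finseq dom_snoc by metis
qed

section \<open>Recursion on finite sequences\<close>

text \<open>The graph of the function is the least subset of \<open>finseq \<times> B\<close> that contains the
  initial pair and is closed under the recursion step.\<close>

definition rec_closed :: "'a \<Rightarrow> ('a \<Rightarrow> 'a \<Rightarrow> 'a \<Rightarrow> 'a) \<Rightarrow> 'a \<Rightarrow> bool" where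
  "rec_closed a H Y \<longleftrightarrow> pair empty a \<epsilon> Y \<and>
    (\<forall>t s i. t \<epsilon> finseq \<and> i \<epsilon> two \<and> pair t s \<epsilon> Y \<longrightarrow> pair (snoc t i) (H t s i) \<epsilon> Y)"

definition rec_graph :: "'a \<Rightarrow> ('a \<Rightarrow> 'a \<Rightarrow> 'a \<Rightarrow> 'a) \<Rightarrow> 'a \<Rightarrow> 'a \<Rightarrow> 'a \<Rightarrow> bool" where
  "rec_graph a H B t s \<longleftrightarrow> t \<epsilon> finseq \<and> s \<epsilon> B \<and>
    (\<forall>Y. rec_closed a H Y \<longrightarrow> pair t s \<epsilon> Y)"

text \<open>Taking the union of all values makes \<open>frec\<close> a \<open>set_of\<close> term,
  hence definable; where the graph has exactly one value, the union is that value.\<close>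

definition frec :: "'a \<Rightarrow> ('a \<Rightarrow> 'a \<Rightarrow> 'a \<Rightarrow> 'a) \<Rightarrow> 'a \<Rightarrow> 'a \<Rightarrow> 'a" where
  "frec a H B t = set_of (\<lambda>z. \<exists>s. rec_graph a H B t s \<and> z \<epsilon> s)"

lemma rec_graph_base: "a \<epsilon> B \<Longrightarrow> rec_graph a H B empty a"
  by (simp add: rec_graph_def rec_closed_def)

lemma rec_graph_step:
  assumes "rec_graph a H B t s" "i \<epsilon> two" "H t s i \<epsilon> B"
  shows "rec_graph a H B (snoc t i) (H t s i)"
  using assms unfolding rec_graph_def rec_closed_def by (simp del: mem_two)

context
  fixes H :: "'a \<Rightarrow> 'a \<Rightarrow> 'a \<Rightarrow> 'a"
  assumes H: "defT (\<lambda>v. H (v 0) (v 1) (v 2))"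
begin

lemmas defT_step = defT_app3[of H, OF H]

lemma defP_rec_graph_var: "defP (\<lambda>v. rec_graph (v 0) H B (v 1) (v 2))"
  unfolding rec_graph_def rec_closed_def by (intro definable defT_step)

lemma defT_frec_var: "defT (\<lambda>v. frec (v 0) H B (v 1))"
  unfolding frec_def
  by (intro definable defP_app3[of "\<lambda>a t s. rec_graph a H B t s", OF defP_rec_graph_var])

lemmas defT_frec = defT_app2[of "\<lambda>a t. frec a H B t" for B, OF defT_frec_var]

text \<open>Removing from the graph the pairs with first component \<open>u\<close> and second component other
  than \<open>w\<close> leaves a closed set, hence the graph has no such pairs.\<close>

lemma rec_graph_remove:
  assumes g: "rec_graph a H B u s"
    and B: "a \<epsilon> B" "\<And>t s i. t \<epsilon> finseq \<Longrightarrow> s \<epsilon> B \<Longrightarrow> i \<epsilon> two \<Longrightarrow> H t s i \<epsilon> B"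
    and base: "u = empty \<Longrightarrow> w = a"
    and step: "\<And>t s i. i \<epsilon> two \<Longrightarrow> u = snoc t i \<Longrightarrow> rec_graph a H B t s \<Longrightarrow> w = H t s i"
  shows "s = w"
proof -
  define P where "P p \<longleftrightarrow> (\<exists>t s. p = pair t s \<and> rec_graph a H B t s \<and> (t = u \<longrightarrow> s = w))" for p
  define Y where "Y = Sep (prod finseq B) P"
  have "defP (\<lambda>v. P (v 0))" unfolding P_def
    by (intro definable defP_app3[of "\<lambda>a t s. rec_graph a H B t s", OF defP_rec_graph_var])
  then have Y: "pair t s \<epsilon> Y \<longleftrightarrow> rec_graph a H B t s \<and> (t = u \<longrightarrow> s = w)" for t s
    unfolding Y_def by (auto simp: mem_Sep P_def rec_graph_def)
  have "rec_closed a H Y"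
    unfolding rec_closed_def Y
  proof (intro conjI allI impI)
    show "rec_graph a H B empty a" by (rule rec_graph_base[OF B(1)])
    show "empty = u \<Longrightarrow> a = w" using base by simp
    fix t s i assume *: "t \<epsilon> finseq \<and> i \<epsilon> two \<and> rec_graph a H B t s \<and> (t = u \<longrightarrow> s = w)"
    then show "rec_graph a H B (snoc t i) (H t s i)"
      using rec_graph_step B(2) rec_graph_def by blast
    show "snoc t i = u \<Longrightarrow> H t s i = w" using step[of i t s] * by metis
  qed
  then have "pair u s \<epsilon> Y" using g unfolding rec_graph_def by blast
  then show ?thesis using Y by blast
qed

lemma rec_graph_unique:
  assumes "t \<epsilon> finseq"
    and B: "a \<epsilon> B" "\<And>t s i. t \<epsilon> finseq \<Longrightarrow> s \<epsilon> B \<Longrightarrow> i \<epsilon> two \<Longrightarrow> H t s i \<epsilon> B"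
  shows "\<exists>s. rec_graph a H B t s \<and> (\<forall>r. rec_graph a H B t r \<longrightarrow> r = s)"
  using assms(1)
proof (induction t rule: finseq_induct)
  case def
  show ?case
    by (intro definable defP_app3[of "\<lambda>a t s. rec_graph a H B t s", OF defP_rec_graph_var])
next
  case empty
  show ?case using rec_graph_base[OF B(1)] rec_graph_remove[OF _ B, of empty _ a] by force
next
  case (snoc t i)
  then obtain s where s: "rec_graph a H B t s" "\<And>r. rec_graph a H B t r \<Longrightarrow> r = s" by blast
  have "rec_graph a H B (snoc t i) (H t s i)"
    using rec_graph_step[OF s(1) snoc(2)] B(2) snoc s(1) rec_graph_def by blast
  moreover have "r = H t s i" if "rec_graph a H B (snoc t i) r" for r
  proof (rule rec_graph_remove[OF that B])
    \<comment> \<open>By injectivity of \<open>snoc\<close> and uniqueness at \<open>t\<close>, a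
      pair over \<open>snoc t i\<close> can arise in one way only.\<close>
    show "H t s i = H t' s' i'"
      if "i' \<epsilon> two" "snoc t i = snoc t' i'" "rec_graph a H B t' s'" for t' s' i'
    proof -
      have "t = t' \<and> i = i'"
        using snoc_inj[of t t' i i'] that snoc rec_graph_def by blast
      then show ?thesis using that s by blast
    qed
  qed simp_all
  ultimately show ?case by blast
qed

lemma frec_eq:
  assumes "rec_graph a H B t s"
    and B: "a \<epsilon> B" "\<And>t s i. t \<epsilon> finseq \<Longrightarrow> s \<epsilon> B \<Longrightarrow> i \<epsilon> two \<Longrightarrow> H t s i \<epsilon> B"
  shows "frec a H B t = s"
proof -
  have "t \<epsilon> finseq" using assms(1) rec_graph_def by blast
  then have "\<And>r. rec_graph a H B t r \<longleftrightarrow> r = s" using rec_graph_unique[OF _ B] assms(1) by metis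
  then have *: "frec a H B t = set_of (\<lambda>z. z \<epsilon> s)" unfolding frec_def by simp
  show ?thesis unfolding * by (rule ext, rule mem_set_of) blast
qed

lemma frec_simps:
  assumes B: "a \<epsilon> B" "\<And>t s i. t \<epsilon> finseq \<Longrightarrow> s \<epsilon> B \<Longrightarrow> i \<epsilon> two \<Longrightarrow> H t s i \<epsilon> B"
  shows "frec a H B empty = a"
    and "t \<epsilon> finseq \<Longrightarrow> i \<epsilon> two \<Longrightarrow> frec a H B (snoc t i) = H t (frec a H B t) i"
    and "t \<epsilon> finseq \<Longrightarrow> frec a H B t \<epsilon> B"
proof -
  show "frec a H B empty = a" using frec_eq[OF rec_graph_base B] B(1) by blast
  have g: "rec_graph a H B t (frec a H B t)" if "t \<epsilon> finseq" for t
    using rec_graph_unique[OF that B] frec_eq[OF _ B] by metis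
  show "t \<epsilon> finseq \<Longrightarrow> frec a H B t \<epsilon> B" using g rec_graph_def by blast
  show "frec a H B (snoc t i) = H t (frec a H B t) i" if "t \<epsilon> finseq" "i \<epsilon> two"
    using frec_eq[OF rec_graph_step[OF g[OF that(1)] that(2)] B] B(2) g that rec_graph_def by blast
qed

end

section \<open>Coding finite sequences by natural numbers\<close>

text \<open>Doubling, by recursion along the sequence of \<open>n\<close> zeros.\<close>

definition dbl :: "'a \<Rightarrow> 'a" where
  "dbl n = frec empty (\<lambda>t s i. succ (succ s)) omega (prod n (succ empty))"

lemma zeros: "n \<epsilon> omega \<Longrightarrow> prod n (succ empty) \<epsilon> finseq"
  and dom_zeros: "n \<epsilon> omega \<Longrightarrow> dom (prod n (succ empty)) = n"
proof -
  have *: "seq (prod n (succ empty)) n"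
    by (rule seqI) (auto simp: mem_prod)
  then show "n \<epsilon> omega \<Longrightarrow> prod n (succ empty) \<epsilon> finseq" using mem_finseq by blast
  show "n \<epsilon> omega \<Longrightarrow> dom (prod n (succ empty)) = n" using * dom_eq by blast
qed

lemma defT_dbl_step: "defT (\<lambda>v. (\<lambda>t s i. succ (succ s)) (v 0) (v 1) (v 2))"
  by (intro definable)

lemma dbl_empty: "dbl empty = empty"
proof -
  have "prod empty (succ empty) = empty" by (rule ext) (simp add: mem_prod)
  then show ?thesis unfolding dbl_def using frec_simps(1)[OF defT_dbl_step, of empty omega] by simp
qed

lemma dbl_succ: "n \<epsilon> omega \<Longrightarrow> dbl (succ n) = succ (succ (dbl n))"
proof -
  assume n: "n \<epsilon> omega"
  have "prod (succ n) (succ empty) = snoc (prod n (succ empty)) empty"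
    by (rule ext) (auto simp: mem_prod dom_zeros[OF n])
  then show ?thesis
    unfolding dbl_def using frec_simps(2)[OF defT_dbl_step, of empty omega] zeros[OF n] by simp
qed

lemma dbl_omega [simp]: "n \<epsilon> omega \<Longrightarrow> dbl n \<epsilon> omega"
  unfolding dbl_def using frec_simps(3)[OF defT_dbl_step, of empty omega] zeros by simp

lemma defT_dbl_var: "defT (\<lambda>v. dbl (v 0))"
  unfolding dbl_def by (intro definable defT_frec[OF defT_dbl_step])
lemmas defT_dbl [definable] = defT_app1[of dbl, OF defT_dbl_var]

text \<open>Parity: two successors are peeled off both sides, which lowers \<open>n\<close> and
  \<open>m\<close> together, so \<open>m\<close> is quantified in the induction.\<close>

lemma dbl_neq_succ_dbl: "n \<epsilon> omega \<Longrightarrow> m \<epsilon> omega \<Longrightarrow> dbl n \<noteq> succ (dbl m)"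
proof -
  have "n \<epsilon> omega \<Longrightarrow> \<forall>m. m \<epsilon> omega \<longrightarrow> dbl n \<noteq> succ (dbl m)"
  proof (induction n rule: omega_induct)
    case def
    show ?case by (intro definable)
  next
    case empty
    show ?case by (simp add: dbl_empty)
  next
    case (succ n)
    show ?case
    proof (intro allI impI)
      fix m assume "m \<epsilon> omega"
      then consider "m = empty" | k where "k \<epsilon> omega" "m = succ k" using omega_cases by blast
      then show "dbl (succ n) \<noteq> succ (dbl m)"
        by cases (use succ in \<open>auto simp: dbl_succ dbl_empty\<close>)
    qed
  qed
  then show "n \<epsilon> omega \<Longrightarrow> m \<epsilon> omega \<Longrightarrow> dbl n \<noteq> succ (dbl m)" by blast
qed

lemma dbl_inj: "n \<epsilon> omega \<Longrightarrow> m \<epsilon> omega \<Longrightarrow> dbl n = dbl m \<longleftrightarrow> n = m"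
proof -
  have "n \<epsilon> omega \<Longrightarrow> \<forall>m. m \<epsilon> omega \<longrightarrow> dbl n = dbl m \<longrightarrow> n = m"
  proof (induction n rule: omega_induct)
    case def
    show ?case by (intro definable)
  next
    case empty
    show ?case using omega_cases dbl_succ dbl_empty succ_neq_empty by metis
  next
    case (succ n)
    then show ?case using omega_cases dbl_succ dbl_empty succ_neq_empty succ_inj by metis
  qed
  then show "n \<epsilon> omega \<Longrightarrow> m \<epsilon> omega \<Longrightarrow> dbl n = dbl m \<longleftrightarrow> n = m" by blast
qed

text \<open>\<open>2n\<close>, \<open>4n + 1\<close> and \<open>4n + 3\<close> are injections with disjoint ranges; they encode the initial
  value and the two ways of extending a sequence.\<close>

definition code_step :: "'a \<Rightarrow> 'a \<Rightarrow> 'a \<Rightarrow> 'a" where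
  "code_step t k i = succ (dbl (if i = empty then dbl k else succ (dbl k)))"

definition code :: "'a \<Rightarrow> 'a \<Rightarrow> 'a" where
  "code n s = frec (dbl n) code_step omega s"

lemma defT_code_step: "defT (\<lambda>v. code_step (v 0) (v 1) (v 2))"
  unfolding code_step_def by (intro definable)

lemma defT_code_var: "defT (\<lambda>v. code (v 0) (v 1))"
  unfolding code_def by (intro definable defT_frec[OF defT_code_step])
lemmas defT_code [definable] = defT_app2[of code, OF defT_code_var]

lemma code_step_omega: "k \<epsilon> omega \<Longrightarrow> code_step t k i \<epsilon> omega"
  by (simp add: code_step_def)

lemma code_step_inj:
  assumes "k \<epsilon> omega" "l \<epsilon> omega" "i \<epsilon> two" "j \<epsilon> two" "code_step t k i = code_step u l j"
  shows "k = l \<and> i = j"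
  using assms dbl_neq_succ_dbl[of k l] dbl_neq_succ_dbl[of l k]
  by (auto simp: code_step_def dbl_inj split: if_splits)

lemma dbl_neq_code_step: "n \<epsilon> omega \<Longrightarrow> k \<epsilon> omega \<Longrightarrow> dbl n \<noteq> code_step t k i"
  unfolding code_step_def by (intro dbl_neq_succ_dbl) simp_all

lemma code_empty: "n \<epsilon> omega \<Longrightarrow> code n empty = dbl n"
  and code_snoc: "n \<epsilon> omega \<Longrightarrow> s \<epsilon> finseq \<Longrightarrow> i \<epsilon> two \<Longrightarrow>
    code n (snoc s i) = code_step s (code n s) i"
  and code_omega: "n \<epsilon> omega \<Longrightarrow> s \<epsilon> finseq \<Longrightarrow> code n s \<epsilon> omega"
  unfolding code_def using frec_simps[OF defT_code_step, of "dbl n" omega] code_step_omega by auto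

lemma code_inj:
  assumes "n \<epsilon> omega" "s \<epsilon> finseq" "m \<epsilon> omega" "t \<epsilon> finseq" "code n s = code m t"
  shows "n = m \<and> s = t"
proof -
  have "\<forall>t. t \<epsilon> finseq \<longrightarrow> code n s = code m t \<longrightarrow> n = m \<and> s = t"
    using assms(2)
  proof (induction s rule: finseq_induct)
    case def
    show ?case by (intro definable)
  next
    case empty
    show ?case
    proof (intro allI impI)
      fix t assume t: "t \<epsilon> finseq" "code n empty = code m t"
      then consider "t = empty" | u i where "u \<epsilon> finseq" "i \<epsilon> two" "t = snoc u i"
        using finseq_cases by blast
      then show "n = m \<and> empty = t"
        by cases (use t assms in \<open>auto simp: code_empty dbl_inj code_snoc code_omega dbl_neq_code_step
            simp del: mem_two\<close>)
    qed
  next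
    case (snoc s i)
    show ?case
    proof (intro allI impI)
      fix t assume t: "t \<epsilon> finseq" "code n (snoc s i) = code m t"
      then consider "t = empty" | u j where "u \<epsilon> finseq" "j \<epsilon> two" "t = snoc u j"
        using finseq_cases by blast
      then show "n = m \<and> snoc s i = t"
      proof cases
        case 1
        then show ?thesis
          using t assms snoc dbl_neq_code_step code_omega code_empty code_snoc by metis
      next
        case 2
        then have "code_step s (code n s) i = code_step u (code m u) j"
          using t assms snoc code_snoc by metis
        then have "code n s = code m u \<and> i = j"
          by (rule code_step_inj[rotated -1]) (use 2 assms snoc code_omega in blast)+
        then show ?thesis using snoc 2 by blast
      qed
    qed
  qed
  then show ?thesis using assms by blast
qed

text \<open>\<open>R\<close> is a partial function on pairs; composed with the inverse of the
  injection \<open>code\<close> it becomes a partial map from \<open>omega\<close> onto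
  \<open>A\<close>.\<close>

lemma countable_if_coded:
  assumes R: "defP (\<lambda>v. R (v 0) (v 1) (v 2))"
    and functional: "\<And>n s x y. R n s x \<Longrightarrow> R n s y \<Longrightarrow> x = y"
    and total: "\<And>x. x \<epsilon> A \<Longrightarrow> \<exists>n s. n \<epsilon> omega \<and> s \<epsilon> finseq \<and> R n s x"
  shows "countable A"
proof (cases "A = empty")
  case False
  then obtain a where a: "a \<epsilon> A" using ext mem_empty by blast
  define C where "C k x \<longleftrightarrow> x \<epsilon> A \<and> (\<exists>n s. n \<epsilon> omega \<and> s \<epsilon> finseq \<and> k = code n s \<and> R n s x)"
    for k x
  \<comment> \<open>Numbers that code no point of \<open>A\<close> are sent to the fixed element
    \<open>a\<close>, which makes \<open>f\<close> total.\<close>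
  define f where "f = Sep (prod omega A) (\<lambda>p. \<exists>k x. p = pair k x \<and>
    (C k x \<or> x = a \<and> \<not> (\<exists>y. C k y)))"
  have "defP (\<lambda>v. C (v i) (v j))" for i j
    unfolding C_def by (intro definable defP_app3[of R, OF R])
  then have def_f: "defP (\<lambda>v. \<exists>k x. v 0 = pair k x \<and> (C k x \<or> x = a \<and> \<not> (\<exists>y. C k y)))"
    by (intro definable)
  have f: "pair k x \<epsilon> f \<longleftrightarrow> k \<epsilon> omega \<and> x \<epsilon> A \<and> (C k x \<or> x = a \<and> \<not> (\<exists>y. C k y))" for k x
    unfolding f_def mem_Sep[OF def_f] by auto
  have C_unique: "x = y" if "C k x" "C k y" for k x y
    using that code_inj functional unfolding C_def by metis
  have "func f omega A"
  proof (rule seqI)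
    show "\<exists>k x. k \<epsilon> omega \<and> x \<epsilon> A \<and> p = pair k x" if "p \<epsilon> f" for p
      using that unfolding f_def mem_Sep[OF def_f] mem_prod by blast
    show "\<exists>x. pair k x \<epsilon> f" if "k \<epsilon> omega" for k
      using that a f C_def by metis
    show "x = y" if "pair k x \<epsilon> f" "pair k y \<epsilon> f" for k x y
      using that f C_unique by metis
  qed
  moreover have "\<exists>k. k \<epsilon> omega \<and> pair k x \<epsilon> f" if "x \<epsilon> A" for x
    using total[OF that] that code_omega unfolding f C_def by blast
  ultimately show ?thesis unfolding countable_def by blast
qed (simp add: countable_def)

text \<open>\<open>pick P\<close> is the sequence with the least code that satisfies \<open>P\<close>.\<close>

definition pick :: "('a \<Rightarrow> bool) \<Rightarrow> 'a" where
  "pick P = set_of (\<lambda>z. \<exists>s. s \<epsilon> finseq \<and> P s \<and>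
    (\<forall>t. t \<epsilon> finseq \<and> P t \<longrightarrow> \<not> code empty t \<epsilon> code empty s) \<and> z \<epsilon> s)"

lemma defT_pick [definable]:
  assumes "defP (\<lambda>v. P (v 0) (\<lambda>n. v (Suc n)))"
  shows "defT (\<lambda>v. pick (\<lambda>s. P s v))"
proof -
  have "defP (\<lambda>v. P (v 0) (\<lambda>n. v (Suc (Suc n))))"
    using defP_reindex[OF assms, of "case_nat 0 (\<lambda>n. Suc (Suc n))"] by simp
  moreover have "defP (\<lambda>v. P (v 0) (\<lambda>n. v (Suc (Suc (Suc n)))))"
    using defP_reindex[OF assms, of "case_nat 0 (\<lambda>n. Suc (Suc (Suc n)))"] by simp
  ultimately show ?thesis unfolding pick_def by (intro definable)
qed

lemma pick:
  assumes P: "defP (\<lambda>v. P (v 0))" and s: "s \<epsilon> finseq" "P s"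
  shows "pick P \<epsilon> finseq" "P (pick P)"
proof -
  define Q where "Q s \<longleftrightarrow> s \<epsilon> finseq \<and> P s \<and>
    (\<forall>t. t \<epsilon> finseq \<and> P t \<longrightarrow> \<not> code empty t \<epsilon> code empty s)" for s
  have "defP (\<lambda>v. \<exists>t. t \<epsilon> finseq \<and> P t \<and> v 0 = code empty t)"
    by (intro definable defP_app1[OF P])
  then obtain k where k: "\<exists>t. t \<epsilon> finseq \<and> P t \<and> k = code empty t"
    "\<And>l. l \<epsilon> k \<Longrightarrow> \<not> (\<exists>t. t \<epsilon> finseq \<and> P t \<and> l = code empty t)"
    by (rule omega_least[where n = "code empty s"]) (use s code_omega in auto)
  then obtain t where t: "t \<epsilon> finseq" "P t" "k = code empty t" by blast
  have Q: "Q r \<longleftrightarrow> r = t" for r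
  proof
    assume r: "Q r"
    then have "\<not> code empty t \<epsilon> code empty r" "\<not> code empty r \<epsilon> code empty t"
      using t k(2) unfolding Q_def by blast+
    then have "code empty t = code empty r" using omega_linear t r code_omega empty_omega unfolding Q_def by metis
    then show "r = t" using code_inj t r empty_omega unfolding Q_def by metis
  next
    show "r = t \<Longrightarrow> Q r" using t k(2) unfolding Q_def by blast
  qed
  have "pick P = set_of (\<lambda>z. \<exists>s. Q s \<and> z \<epsilon> s)" unfolding pick_def Q_def by (simp add: conj_assoc)
  also have "\<dots> = t" unfolding Q by (rule ext, rule trans[OF mem_set_of]) auto
  finally show "pick P \<epsilon> finseq" "P (pick P)" using t by simp_all
qed

section \<open>Scattered sets and iterated derivatives\<close>

definition dense_in_itself :: "'a \<Rightarrow> bool" where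
  "dense_in_itself K \<longleftrightarrow> (\<forall>x s. x \<epsilon> K \<and> s \<epsilon> finseq \<and> subset s x \<longrightarrow>
    (\<exists>y. y \<epsilon> K \<and> subset s y \<and> y \<noteq> x))"

text \<open>The Cantor-Bendixson derivative relative to \<open>K\<close>: isolated points are
  removed, and limit points outside \<open>K\<close> are not added.\<close>

definition der :: "'a \<Rightarrow> 'a" where
  "der K = Sep K (\<lambda>x. \<forall>s. s \<epsilon> finseq \<and> subset s x \<longrightarrow> (\<exists>y. y \<epsilon> K \<and> subset s y \<and> y \<noteq> x))"

lemma mem_der:
  "x \<epsilon> der K \<longleftrightarrow> x \<epsilon> K \<and>
    (\<forall>s. s \<epsilon> finseq \<and> subset s x \<longrightarrow> (\<exists>y. y \<epsilon> K \<and> subset s y \<and> y \<noteq> x))"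
  unfolding der_def by (rule mem_Sep) (intro definable)

lemma defT_der_var: "defT (\<lambda>v. der (v 0))"
  unfolding der_def by (intro definable)
lemmas defT_der [definable] = defT_app1[of der, OF defT_der_var]

text \<open>Intersection relative to \<open>G\<close>: the empty family yields \<open>G\<close>,
  which is how the tower gets its first member.\<close>

definition meet :: "'a \<Rightarrow> 'a \<Rightarrow> 'a" where
  "meet G Z = Sep G (\<lambda>x. \<forall>C. C \<epsilon> Z \<longrightarrow> x \<epsilon> C)"

lemma mem_meet: "x \<epsilon> meet G Z \<longleftrightarrow> x \<epsilon> G \<and> (\<forall>C. C \<epsilon> Z \<longrightarrow> x \<epsilon> C)"
  unfolding meet_def by (rule mem_Sep) (intro definable)

lemma defT_meet_var: "defT (\<lambda>v. meet (v 0) (v 1))"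
  unfolding meet_def by (intro definable)
lemmas defT_meet [definable] = defT_app2[of meet, OF defT_meet_var]

text \<open>The members of the tower of \<open>G\<close> are the iterated Cantor-Bendixson derivatives of \<open>G\<close>;
  describing them by closure conditions avoids ordinals.\<close>

definition tower :: "'a \<Rightarrow> 'a \<Rightarrow> bool" where
  "tower G C \<longleftrightarrow> subset C G \<and> (\<forall>Y. (\<forall>D. D \<epsilon> Y \<longrightarrow> der D \<epsilon> Y) \<and>
    (\<forall>Z. subset Z Y \<longrightarrow> meet G Z \<epsilon> Y) \<longrightarrow> C \<epsilon> Y)"

lemma defP_tower_var: "defP (\<lambda>v. tower (v 0) (v 1))"
  unfolding tower_def by (intro definable)
lemmas defP_tower [definable] = defP_app2[of tower, OF defP_tower_var]

lemma der_subset: "subset (der C) C"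
  by (simp add: subset_def mem_der)

lemma tower_subset: "tower G C \<Longrightarrow> subset C G"
  by (simp add: tower_def)

lemma tower_der: "tower G C \<Longrightarrow> tower G (der C)"
  unfolding tower_def using der_subset subset_trans by blast

lemma tower_meet:
  assumes "\<And>C. C \<epsilon> Z \<Longrightarrow> tower G C"
  shows "tower G (meet G Z)"
  unfolding tower_def
proof (intro conjI allI impI)
  show "subset (meet G Z) G" by (simp add: subset_def mem_meet)
  fix Y assume Y: "(\<forall>D. D \<epsilon> Y \<longrightarrow> der D \<epsilon> Y) \<and> (\<forall>Z. subset Z Y \<longrightarrow> meet G Z \<epsilon> Y)"
  then have "subset Z Y" using assms unfolding tower_def subset_def by blast
  then show "meet G Z \<epsilon> Y" using Y by blast
qed

text \<open>The starting set \<open>G\<close> is covered by the case \<open>meet\<close> with an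
  empty \<open>Z\<close>.\<close>

lemma tower_induct [consumes 1, case_names def der meet]:
  assumes "tower G C" "defP (\<lambda>v. P (v 0))"
    "\<And>C. tower G C \<Longrightarrow> P C \<Longrightarrow> P (der C)"
    "\<And>Z. (\<And>C. C \<epsilon> Z \<Longrightarrow> tower G C) \<Longrightarrow> (\<And>C. C \<epsilon> Z \<Longrightarrow> P C) \<Longrightarrow> P (meet G Z)"
  shows "P C"
proof -
  define Y where "Y = Sep (pow G) (\<lambda>C. tower G C \<and> P C)"
  have def_Y: "defP (\<lambda>v. tower G (v 0) \<and> P (v 0))" by (intro definable assms(2))
  have Y: "D \<epsilon> Y \<longleftrightarrow> tower G D \<and> P D" for D
    unfolding Y_def mem_Sep[OF def_Y] using tower_subset by auto
  have "\<forall>D. D \<epsilon> Y \<longrightarrow> der D \<epsilon> Y" using Y assms(3) tower_der by blast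
  moreover have "\<forall>Z. subset Z Y \<longrightarrow> meet G Z \<epsilon> Y"
  proof (intro allI impI)
    fix Z assume "subset Z Y"
    then have "\<And>C. C \<epsilon> Z \<Longrightarrow> tower G C" "\<And>C. C \<epsilon> Z \<Longrightarrow> P C" using Y subsetD by blast+
    then show "meet G Z \<epsilon> Y" unfolding Y using tower_meet assms(4) by blast
  qed
  ultimately show ?thesis using assms(1) Y unfolding tower_def by blast
qed

text \<open>Bourbaki's argument: every member \<open>C\<close> of the tower is extreme, i.e. \<open>C \<subseteq> der D\<close> for
  all members \<open>D\<close> properly above \<open>C\<close>, and no member lies strictly between \<open>der C\<close> and an
  extreme \<open>C\<close>.\<close>

definition extreme :: "'a \<Rightarrow> 'a \<Rightarrow> bool" where
  "extreme G C \<longleftrightarrow> (\<forall>D. tower G D \<and> subset C D \<and> C \<noteq> D \<longrightarrow> subset C (der D))"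

lemma tower_gap:
  assumes "tower G D" "tower G C" "extreme G C"
  shows "subset C D \<or> subset D (der C)"
  using assms(1)
proof (induction D rule: tower_induct)
  case def
  show ?case by (intro definable)
next
  case (der D)
  \<comment> \<open>If \<open>D\<close> lies properly above \<open>C\<close>, extremeness gives
    \<open>C\<close> below \<open>der D\<close>; if \<open>D = C\<close>, then
    \<open>der D = der C\<close>; if \<open>D\<close> is below \<open>der C\<close>, so is
    \<open>der D\<close>.\<close>
  then show ?case using assms(3) der_subset subset_trans subset_refl unfolding extreme_def by metis
next
  case (meet Z)
  show ?case
  proof (cases "\<forall>D. D \<epsilon> Z \<longrightarrow> subset C D")
    case True
    then show ?thesis
      using tower_subset[OF \<open>tower G C\<close>] unfolding subset_def mem_meet by blast
  next
    case False
    then obtain D where "D \<epsilon> Z" "subset D (der C)" using meet by blast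
    then show ?thesis unfolding subset_def mem_meet by blast
  qed
qed

lemma tower_extreme: "tower G C \<Longrightarrow> extreme G C"
proof (induction C rule: tower_induct)
  case def
  show ?case unfolding extreme_def by (intro definable)
next
  case (der C)
  show ?case
    unfolding extreme_def
  proof (intro allI impI)
    fix D assume D: "tower G D \<and> subset (der C) D \<and> der C \<noteq> D"
    \<comment> \<open>The other alternative of \<open>tower_gap\<close> would force
      \<open>D = der C\<close>.\<close>
    then have "subset C D" using tower_gap der subset_antisym by blast
    then show "subset (der C) (der D)"
      using der(2) D der_subset subset_trans subset_refl unfolding extreme_def by metis
  qed
next
  case (meet Z)
  show ?case
    unfolding extreme_def
  proof (intro allI impI)
    fix D assume D: "tower G D \<and> subset (meet G Z) D \<and> meet G Z \<noteq> D"
    then have "\<not> subset D (meet G Z)" using subset_antisym by blast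
    \<comment> \<open>Some \<open>C\<close> in \<open>Z\<close> fails to contain \<open>D\<close>;
      the gap property puts this \<open>C\<close> properly below \<open>D\<close>, and its
      extremeness carries over to the smaller intersection.\<close>
    then obtain C where C: "C \<epsilon> Z" "\<not> subset D C"
      using D tower_subset[of G D] unfolding subset_def mem_meet by blast
    then have "subset C D" using tower_gap[of G D C] meet D der_subset subset_trans by blast
    then have "subset C (der D)" using C meet D subset_refl unfolding extreme_def by metis
    then show "subset (meet G Z) (der D)" using C unfolding subset_def mem_meet by blast
  qed
qed

lemma tower_linear: "tower G C \<Longrightarrow> tower G D \<Longrightarrow> subset C D \<or> subset D C"
  using tower_gap tower_extreme der_subset subset_trans by blast

text \<open>For \<open>x\<close> in \<open>G\<close> this is the last derivative that contains
  \<open>x\<close>, found as the intersection of all that do; it replaces the ordinal rank of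
  \<open>x\<close>.\<close>

definition stage :: "'a \<Rightarrow> 'a \<Rightarrow> 'a" where
  "stage G x = meet G (Sep (pow G) (\<lambda>C. tower G C \<and> x \<epsilon> C))"

lemma defT_stage_var: "defT (\<lambda>v. stage (v 0) (v 1))"
  unfolding stage_def by (intro definable)
lemmas defT_stage [definable] = defT_app2[of stage, OF defT_stage_var]

lemma mem_tower_at:
  "C \<epsilon> Sep (pow G) (\<lambda>C. tower G C \<and> x \<epsilon> C) \<longleftrightarrow> tower G C \<and> x \<epsilon> C"
proof -
  have "defP (\<lambda>v. tower G (v 0) \<and> x \<epsilon> v 0)" by (intro definable)
  then show ?thesis by (subst mem_Sep) (use tower_subset in auto)
qed

lemma mem_stage: "y \<epsilon> stage G x \<longleftrightarrow> y \<epsilon> G \<and> (\<forall>C. tower G C \<and> x \<epsilon> C \<longrightarrow> y \<epsilon> C)"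
  unfolding stage_def mem_meet mem_tower_at ..

lemma tower_stage: "tower G (stage G x)"
  unfolding stage_def by (rule tower_meet) (simp add: mem_tower_at)

definition isolates :: "'a \<Rightarrow> 'a \<Rightarrow> 'a \<Rightarrow> bool" where
  "isolates G s x \<longleftrightarrow> x \<epsilon> G \<and> subset s x \<and> (\<forall>y. y \<epsilon> stage G x \<and> subset s y \<longrightarrow> y = x)"

lemma defP_isolates_var: "defP (\<lambda>v. isolates (v 0) (v 1) (v 2))"
  unfolding isolates_def by (intro definable)
lemmas defP_isolates [definable] = defP_app3[of isolates, OF defP_isolates_var]

text \<open>Of the two stages one contains the other, say that of \<open>y\<close> contains that of
  \<open>x\<close>. Then \<open>x\<close> lies in the stage of \<open>y\<close> and in the cylinder
  of \<open>s\<close>, where \<open>y\<close> is the only point.\<close>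

lemma isolates_unique: "isolates G s x \<Longrightarrow> isolates G s y \<Longrightarrow> x = y"
  using tower_linear[OF tower_stage tower_stage, of G x y]
  unfolding isolates_def subset_def using mem_stage by blast

lemma isolates_total:
  assumes "\<And>K. subset K G \<Longrightarrow> dense_in_itself K \<Longrightarrow> K = empty" "x \<epsilon> G"
  shows "\<exists>s. s \<epsilon> finseq \<and> isolates G s x"
proof (rule ccontr)
  assume *: "\<not> ?thesis"
  have x: "x \<epsilon> stage G x" using assms(2) mem_stage by blast
  then have "x \<epsilon> der (stage G x)" using * assms(2) unfolding isolates_def mem_der by metis
  \<comment> \<open>\<open>der (stage G x)\<close> is itself a member of the tower containing
    \<open>x\<close>, and the stage is the least such member.\<close>
  then have "subset (stage G x) (der (stage G x))"
    using tower_der[OF tower_stage] mem_stage unfolding subset_def by blast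
  then have "dense_in_itself (stage G x)"
    unfolding dense_in_itself_def subset_def mem_der by blast
  moreover have "subset (stage G x) G" using tower_stage tower_subset by blast
  ultimately show False using assms(1) x mem_empty by metis
qed

lemma countable_union_scattered:
  assumes "countable F"
    and scattered: "\<And>G K. G \<epsilon> F \<Longrightarrow> subset K G \<Longrightarrow> dense_in_itself K \<Longrightarrow> K = empty"
  shows "countable (big_union F)"
proof (cases "F = empty")
  case True
  then have "big_union F = empty" by (intro ext) simp
  then show ?thesis by (simp add: countable_def)
next
  case False
  then obtain f where f: "func f omega F" "\<And>G. G \<epsilon> F \<Longrightarrow> \<exists>n. n \<epsilon> omega \<and> pair n G \<epsilon> f"
    using assms(1) unfolding countable_def by blast
  show ?thesis
  proof (rule countable_if_coded)
    \<comment> \<open>\<open>n\<close> determines \<open>G\<close> because \<open>f\<close> is a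
      function, and then \<open>s\<close> determines the point; \<open>isolates\<close> mentions
      \<open>G\<close> as a set, without any representation of it.\<close>
    show "defP (\<lambda>v. \<exists>G. pair (v 0) G \<epsilon> f \<and> isolates G (v 1) (v 2))" by (intro definable)
    show "x = y" if "\<exists>G. pair n G \<epsilon> f \<and> isolates G s x" "\<exists>G. pair n G \<epsilon> f \<and> isolates G s y"
      for n s x y
      using that seq_unique[OF f(1)] isolates_unique by metis
    show "\<exists>n s. n \<epsilon> omega \<and> s \<epsilon> finseq \<and> (\<exists>G. pair n G \<epsilon> f \<and> isolates G s x)"
      if "x \<epsilon> big_union F" for x
      using that f(2) isolates_total scattered unfolding mem_big_union by meson
  qed
qed

section \<open>Perfect subsets of G-delta sets\<close>

lemma mem_cylinder [simp]: "x \<epsilon> cylinder s \<longleftrightarrow> x \<epsilon> cantor \<and> subset s x"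
  unfolding cylinder_def by (intro mem_set_of separation_definable definable)

lemma cylinder_mono: "subset s t \<Longrightarrow> subset (cylinder t) (cylinder s)"
  by (rule subsetI) (use subset_trans in auto)

lemma defT_cylinder_var: "defT (\<lambda>v. cylinder (v 0))"
  unfolding cylinder_def by (intro definable)
lemmas defT_cylinder [definable] = defT_app1[of cylinder, OF defT_cylinder_var]

lemma is_open_iff:
  "is_open U \<longleftrightarrow> subset U cantor \<and>
    (\<forall>x. x \<epsilon> U \<longrightarrow> (\<exists>s. s \<epsilon> finseq \<and> subset s x \<and> subset (cylinder s) U))"
proof
  assume "is_open U"
  then obtain F where F: "\<And>B. B \<epsilon> F \<Longrightarrow> \<exists>s. s \<epsilon> finseq \<and> B = cylinder s" "U = big_union F"
    unfolding is_open_def by blast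
  show "subset U cantor \<and>
    (\<forall>x. x \<epsilon> U \<longrightarrow> (\<exists>s. s \<epsilon> finseq \<and> subset s x \<and> subset (cylinder s) U))"
  proof (intro conjI allI impI subsetI)
    fix x assume "x \<epsilon> U"
    then obtain B where B: "B \<epsilon> F" "x \<epsilon> B" unfolding F(2) by auto
    then obtain s where s: "s \<epsilon> finseq" "B = cylinder s" using F(1) by blast
    have "subset B U" using B(1) unfolding F(2) subset_def mem_big_union by blast
    then show "\<exists>s. s \<epsilon> finseq \<and> subset s x \<and> subset (cylinder s) U" "x \<epsilon> cantor"
      using B(2) s mem_cylinder by blast+
  qed
next
  assume U: "subset U cantor \<and>
    (\<forall>x. x \<epsilon> U \<longrightarrow> (\<exists>s. s \<epsilon> finseq \<and> subset s x \<and> subset (cylinder s) U))"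
  \<comment> \<open>Taking all cylinders inside \<open>U\<close> avoids choosing one for each
    point.\<close>
  define F where "F = Sep (pow U) (\<lambda>B. \<exists>s. s \<epsilon> finseq \<and> B = cylinder s)"
  have "defP (\<lambda>v. \<exists>s. s \<epsilon> finseq \<and> v 0 = cylinder s)" by (intro definable)
  then have F: "B \<epsilon> F \<longleftrightarrow> subset B U \<and> (\<exists>s. s \<epsilon> finseq \<and> B = cylinder s)" for B
    unfolding F_def by (subst mem_Sep) auto
  have "U = big_union F"
  proof (rule ext)
    fix x
    show "x \<epsilon> U \<longleftrightarrow> x \<epsilon> big_union F"
    proof
      assume "x \<epsilon> U"
      then obtain s where "s \<epsilon> finseq" "subset s x" "subset (cylinder s) U" "x \<epsilon> cantor"
        using U subsetD by blast
      then have "cylinder s \<epsilon> F" "x \<epsilon> cylinder s" using F mem_cylinder by blast+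
      then show "x \<epsilon> big_union F" unfolding mem_big_union by blast
    next
      assume "x \<epsilon> big_union F"
      then show "x \<epsilon> U" using F subsetD unfolding mem_big_union by blast
    qed
  qed
  then show "is_open U" unfolding is_open_def using F by blast
qed

section \<open>Splitting and the Cantor scheme\<close>

lemma succ_subset_mono:
  "m \<epsilon> omega \<Longrightarrow> n \<epsilon> omega \<Longrightarrow> subset m n \<Longrightarrow> subset (succ m) (succ n)"
  using omega_linear[of m n] mem_irrefl unfolding subset_def by (metis mem_succ)

text \<open>Two distinct points split at the restriction to the least argument where they differ.\<close>

lemma cantor_split:
  assumes x: "x \<epsilon> cantor" and y: "y \<epsilon> cantor" and neq: "x \<noteq> y"
    and q: "q \<epsilon> finseq" "subset q x" "subset q y"
  obtains r i j where "r \<epsilon> finseq" "subset q r" "i \<epsilon> two" "j \<epsilon> two" "i \<noteq> j"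
    "subset (snoc r i) x" "subset (snoc r j) y"
proof -
  have seqs: "seq x omega" "seq y omega" using x y by simp_all
  have "\<exists>k i. pair k i \<epsilon> x \<and> \<not> pair k i \<epsilon> y" using neq seq_ext[OF seqs] by blast
  then obtain k where k: "k \<epsilon> omega" "\<exists>i. pair k i \<epsilon> x \<and> \<not> pair k i \<epsilon> y"
    using seq_pairD[OF seqs(1)] by blast
  have "defP (\<lambda>v. \<exists>i. pair (v 0) i \<epsilon> x \<and> \<not> pair (v 0) i \<epsilon> y)" by (intro definable)
  then obtain m where m: "m \<epsilon> omega" "\<exists>i. pair m i \<epsilon> x \<and> \<not> pair m i \<epsilon> y"
    "\<And>l. l \<epsilon> m \<Longrightarrow> \<not> (\<exists>i. pair l i \<epsilon> x \<and> \<not> pair l i \<epsilon> y)"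
    using k by (rule omega_least) blast
  define r where "r = restrict x m"
  have r: "r \<epsilon> finseq" "dom r = m" "subset r x"
    using restrict_finseq[OF x m(1)] dom_restrict[OF x m(1)] by (simp_all add: r_def)
  \<comment> \<open>By minimality of \<open>m\<close>, all pairs of \<open>x\<close> below
    \<open>m\<close> belong to \<open>y\<close>.\<close>
  have ry: "subset r y"
    unfolding r_def subset_def mem_restrict using m(3) by blast
  obtain i where i: "i \<epsilon> two" "pair m i \<epsilon> x" "\<not> pair m i \<epsilon> y"
    using m(2) seq_pairD[OF seqs(1)] by blast
  obtain j where j: "j \<epsilon> two" "pair m j \<epsilon> y" using seq_total[OF seqs(2) m(1)] by blast
  \<comment> \<open>Both points extend \<open>q\<close> and hence agree on its domain, so they split
    at or beyond its end.\<close>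
  have "\<not> m \<epsilon> dom q"
  proof
    assume "m \<epsilon> dom q"
    then obtain l where "pair m l \<epsilon> q" using finseq_seq[OF q(1)] seq_total by blast
    then show False using i q seq_unique[OF seqs(1)] subsetD by metis
  qed
  then have "subset (dom q) m"
    using omega_linear[OF m(1) finseq_dom[OF q(1)]] omega_mem_trans[OF m(1)]
    unfolding subset_def by metis
  then have "subset q r"
    using seq_subset_chain[OF finseq_seq[OF q(1)] finseq_seq[OF r(1)] seqs(1) q(2) r(3)] r(2) by simp
  moreover have "subset (snoc r i) x" "subset (snoc r j) y"
    using r ry i j unfolding subset_def mem_snoc by auto
  ultimately show thesis using that r(1) i j by metis
qed

definition good :: "'a \<Rightarrow> 'a \<Rightarrow> bool" where
  "good K s \<longleftrightarrow> s \<epsilon> finseq \<and> (\<exists>x. x \<epsilon> K \<and> subset s x)"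

text \<open>A place where the scheme can branch after entering the open set with index
  \<open>n\<close>. Quantifying over all \<open>U\<close> makes the last clause vacuous where
  \<open>f\<close> has no value.\<close>

definition node :: "'a \<Rightarrow> 'a \<Rightarrow> 'a \<Rightarrow> 'a \<Rightarrow> 'a \<Rightarrow> bool" where
  "node K f n s r \<longleftrightarrow> subset s r \<and> (\<forall>i. i \<epsilon> two \<longrightarrow> good K (snoc r i)) \<and>
    (\<forall>U. pair n U \<epsilon> f \<longrightarrow> subset (cylinder r) U)"

definition next_node :: "'a \<Rightarrow> 'a \<Rightarrow> 'a \<Rightarrow> 'a \<Rightarrow> 'a" where
  "next_node K f n s = pick (node K f n s)"

text \<open>The length of the index \<open>t\<close> doubles as the index of the open set to be
  entered.\<close>

definition scheme_step :: "'a \<Rightarrow> 'a \<Rightarrow> 'a \<Rightarrow> 'a \<Rightarrow> 'a \<Rightarrow> 'a" where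
  "scheme_step K f t s i = snoc (next_node K f (dom t) s) i"

definition scheme :: "'a \<Rightarrow> 'a \<Rightarrow> 'a \<Rightarrow> 'a" where
  "scheme K f t = frec empty (scheme_step K f) (Sep finseq (good K)) t"

definition branch :: "'a \<Rightarrow> 'a \<Rightarrow> 'a \<Rightarrow> 'a" where
  "branch K f y = set_of (\<lambda>p. \<exists>n. n \<epsilon> omega \<and> p \<epsilon> scheme K f (restrict y n))"

lemma defP_good_var: "defP (\<lambda>v. good K (v 0))"
  unfolding good_def by (intro definable)
lemmas defP_good [definable] = defP_app1[of "good K" for K, OF defP_good_var]

lemma defP_node_var: "defP (\<lambda>v. node K f (v 0) (v 1) (v 2))"
  unfolding node_def by (intro definable)
lemmas defP_node [definable] = defP_app3[of "node K f" for K f, OF defP_node_var]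

lemma defT_next_node_var: "defT (\<lambda>v. next_node K f (v 0) (v 1))"
  unfolding next_node_def by (intro definable)
lemmas defT_next_node [definable] = defT_app2[of "next_node K f" for K f, OF defT_next_node_var]

lemma defT_scheme_step: "defT (\<lambda>v. scheme_step K f (v 0) (v 1) (v 2))"
  unfolding scheme_step_def by (intro definable)

lemma defT_scheme_var: "defT (\<lambda>v. scheme K f (v 0))"
  unfolding scheme_def by (intro definable defT_frec[OF defT_scheme_step])
lemmas defT_scheme [definable] = defT_app1[of "scheme K f" for K f, OF defT_scheme_var]

lemma defT_branch_var: "defT (\<lambda>v. branch K f (v 0))"
  unfolding branch_def by (intro definable)
lemmas defT_branch [definable] = defT_app1[of "branch K f" for K f, OF defT_branch_var]

context
  fixes K f
  assumes K: "subset K cantor" "dense_in_itself K" "K \<noteq> empty"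
    and f: "\<And>n U. pair n U \<epsilon> f \<Longrightarrow> is_open U \<and> subset K U"
      "\<And>n U V. pair n U \<epsilon> f \<Longrightarrow> pair n V \<epsilon> f \<Longrightarrow> U = V"
begin

text \<open>A point \<open>x\<close> of \<open>K\<close> above \<open>s\<close> is followed until
  its cylinder lies in the open set; density in itself supplies a second point of \<open>K\<close>
  there, and the two are separated.\<close>

lemma ex_node:
  assumes "good K s"
  shows "\<exists>r. r \<epsilon> finseq \<and> node K f n s r"
proof -
  obtain x where s: "s \<epsilon> finseq" and x: "x \<epsilon> K" "subset s x" using assms unfolding good_def by blast
  have xc: "x \<epsilon> cantor" using x K(1) subsetD by blast
  then have xs: "seq x omega" by simp
  have "\<exists>q. q \<epsilon> finseq \<and> subset q x \<and> subset s q \<and> (\<forall>U. pair n U \<epsilon> f \<longrightarrow> subset (cylinder q) U)"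
  proof (cases "\<exists>U. pair n U \<epsilon> f")
    case True
    then obtain U where U: "pair n U \<epsilon> f" "x \<epsilon> U" "is_open U" using f(1) x subsetD by blast
    then obtain u where u: "u \<epsilon> finseq" "subset u x" "subset (cylinder u) U"
      using is_open_iff by blast
    have V: "V = U" if "pair n V \<epsilon> f" for V using that U(1) f(2) by blast
    \<comment> \<open>Both are initial segments of \<open>x\<close>; the longer one will serve as
      \<open>q\<close>.\<close>
    have "subset u s \<or> subset s u"
      using omega_linear_subset[OF finseq_dom[OF s] finseq_dom[OF u(1)]]
        seq_subset_chain[OF finseq_seq[OF s] finseq_seq[OF u(1)] xs x(2) u(2)]
        seq_subset_chain[OF finseq_seq[OF u(1)] finseq_seq[OF s] xs u(2) x(2)] by blast
    then show ?thesis
    proof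
      assume "subset u s"
      then have "subset (cylinder s) U" using cylinder_mono u(3) subset_trans by blast
      then have "subset (cylinder s) V" if "pair n V \<epsilon> f" for V using V[OF that] by simp
      then show ?thesis using s x(2) by (intro exI[of _ s]) simp
    next
      assume "subset s u"
      moreover have "subset (cylinder u) V" if "pair n V \<epsilon> f" for V using V[OF that] u(3) by simp
      ultimately show ?thesis using u(1,2) by (intro exI[of _ u]) simp
    qed
  next
    case False
    then show ?thesis using s x by (intro exI[of _ s]) simp
  qed
  then obtain q where q: "q \<epsilon> finseq" "subset q x" "subset s q"
    "\<And>U. pair n U \<epsilon> f \<Longrightarrow> subset (cylinder q) U" by blast
  obtain y where y: "y \<epsilon> K" "subset q y" "y \<noteq> x"
    using K(2) x q unfolding dense_in_itself_def by blast
  then have "y \<epsilon> cantor" "x \<noteq> y" using K(1) subsetD by blast+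
  then obtain r i j where r: "r \<epsilon> finseq" "subset q r" "i \<epsilon> two" "j \<epsilon> two" "i \<noteq> j"
    "subset (snoc r i) x" "subset (snoc r j) y"
    using cantor_split[OF xc _ _ q(1,2) y(2)] by blast
  have "good K (snoc r l)" if "l \<epsilon> two" for l
  proof -
    have "l = i \<or> l = j" using that r(3-5) unfolding mem_two by blast
    then show ?thesis using r x y unfolding good_def using snoc_finseq by blast
  qed
  moreover have "subset (cylinder r) U" if "pair n U \<epsilon> f" for U
    using q(4)[OF that] cylinder_mono[OF r(2)] subset_trans by blast
  moreover have "subset s r" using q(3) r(2) subset_trans by blast
  ultimately show ?thesis using r(1) unfolding node_def by (intro exI[of _ r]) simp
qed

lemma next_node:
  assumes "good K s"
  shows "next_node K f n s \<epsilon> finseq" "node K f n s (next_node K f n s)"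
proof -
  obtain r where "r \<epsilon> finseq" "node K f n s r" using ex_node assms by blast
  moreover have "defP (\<lambda>v. node K f n s (v 0))" by (intro definable)
  ultimately show "next_node K f n s \<epsilon> finseq" "node K f n s (next_node K f n s)"
    unfolding next_node_def using pick by blast+
qed

lemma mem_good: "s \<epsilon> Sep finseq (good K) \<longleftrightarrow> good K s"
  using mem_Sep[OF defP_good_var] unfolding good_def by blast

lemma good_empty: "empty \<epsilon> Sep finseq (good K)"
  unfolding mem_good good_def using K(3) ext mem_empty empty_finseq empty_subset by metis

lemma good_step:
  "s \<epsilon> Sep finseq (good K) \<Longrightarrow> i \<epsilon> two \<Longrightarrow> scheme_step K f t s i \<epsilon> Sep finseq (good K)"
  unfolding mem_good scheme_step_def using next_node node_def by blast

lemma scheme_good: "t \<epsilon> finseq \<Longrightarrow> good K (scheme K f t)"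
  unfolding scheme_def
  by (rule iffD1[OF mem_good], rule frec_simps(3)[OF defT_scheme_step good_empty good_step])

lemma scheme_finseq: "t \<epsilon> finseq \<Longrightarrow> scheme K f t \<epsilon> finseq"
  using scheme_good good_def by blast

lemma scheme_snoc: "t \<epsilon> finseq \<Longrightarrow> i \<epsilon> two \<Longrightarrow>
    scheme K f (snoc t i) = snoc (next_node K f (dom t) (scheme K f t)) i"
proof -
  assume "t \<epsilon> finseq" "i \<epsilon> two"
  then have "scheme K f (snoc t i) = scheme_step K f t (scheme K f t) i"
    unfolding scheme_def
    by (intro frec_simps(2)[OF defT_scheme_step good_empty]) (use good_step in blast)+
  then show ?thesis by (simp only: scheme_step_def)
qed

lemma scheme_next: "t \<epsilon> finseq \<Longrightarrow> subset (scheme K f t) (next_node K f (dom t) (scheme K f t))"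
  using next_node scheme_good node_def by blast

lemma scheme_mono:
  assumes "t \<epsilon> finseq" "s \<epsilon> finseq" "subset s t"
  shows "subset (scheme K f s) (scheme K f t)"
proof -
  have "subset s t \<longrightarrow> subset (scheme K f s) (scheme K f t)"
    using assms(1)
  proof (induction t rule: finseq_induct)
    case def
    show ?case by (intro definable)
  next
    case empty
    show ?case using subset_antisym empty_subset subset_refl by metis
  next
    case (snoc t i)
    then have "subset (scheme K f t) (scheme K f (snoc t i))"
      using scheme_snoc scheme_next snoc_superset subset_trans by metis
    then show ?case using subset_snoc[OF assms(2) snoc(1,2)] snoc(3) subset_trans subset_refl by metis
  qed
  then show ?thesis using assms(3) by blast
qed

text \<open>Each step appends at least one entry. This growth makes branches total and gives the
  modulus of continuity in \<open>subset_branch\<close>.\<close>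

lemma dom_scheme: "t \<epsilon> finseq \<Longrightarrow> subset (dom t) (dom (scheme K f t))"
proof (induction t rule: finseq_induct)
  case def
  show ?case by (intro definable)
next
  case empty
  show ?case by simp
next
  case (snoc t i)
  have n: "next_node K f (dom t) (scheme K f t) \<epsilon> finseq" using next_node scheme_good snoc by blast
  have "subset (dom (scheme K f t)) (dom (next_node K f (dom t) (scheme K f t)))"
    using seq_subset_dom[OF finseq_seq finseq_seq] scheme_next snoc scheme_finseq n by blast
  then have "subset (dom t) (dom (next_node K f (dom t) (scheme K f t)))"
    using snoc subset_trans by blast
  then have "subset (succ (dom t)) (succ (dom (next_node K f (dom t) (scheme K f t))))"
    using succ_subset_mono snoc(1) n finseq_dom by blast
  then show ?case using snoc(1,2) n scheme_snoc dom_snoc by metis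
qed

section \<open>Branches of the scheme\<close>

lemma mem_branch:
  assumes "y \<epsilon> cantor"
  shows "p \<epsilon> branch K f y \<longleftrightarrow> (\<exists>n. n \<epsilon> omega \<and> p \<epsilon> scheme K f (restrict y n))"
  unfolding branch_def
proof (rule mem_set_of_bounded)
  show "defP (\<lambda>v. \<exists>n. n \<epsilon> omega \<and> v 0 \<epsilon> scheme K f (restrict y n))" by (intro definable)
  show "p \<epsilon> prod omega two" if p: "\<exists>n. n \<epsilon> omega \<and> p \<epsilon> scheme K f (restrict y n)" for p
  proof -
    obtain s where "s \<epsilon> finseq" "p \<epsilon> s" using p scheme_finseq restrict_finseq[OF assms] by blast
    then show ?thesis using finseq_seq finseq_dom mem_omega_omega unfolding mem_prod
      by (metis seq_pairE)
  qed
qed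

lemma restrict_mono: "subset n m \<Longrightarrow> subset (restrict y n) (restrict y m)"
  unfolding subset_def mem_restrict by blast

lemma branch_cantor:
  assumes y: "y \<epsilon> cantor"
  shows "branch K f y \<epsilon> cantor"
  unfolding mem_cantor
proof (rule seqI)
  note seqs = finseq_seq[OF scheme_finseq[OF restrict_finseq[OF y]]]
  note doms = finseq_dom[OF scheme_finseq[OF restrict_finseq[OF y]]]
  show "\<exists>k i. k \<epsilon> omega \<and> i \<epsilon> two \<and> p = pair k i" if "p \<epsilon> branch K f y" for p
    using that seqs doms mem_omega_omega unfolding mem_branch[OF y] by (metis seq_pairE)
  show "\<exists>i. pair k i \<epsilon> branch K f y" if k: "k \<epsilon> omega" for k
  proof -
    have "subset (succ k) (dom (scheme K f (restrict y (succ k))))"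
      using dom_scheme[OF restrict_finseq[OF y]] dom_restrict[OF y] k succ_omega by metis
    then have "k \<epsilon> dom (scheme K f (restrict y (succ k)))" using subsetD mem_succ by blast
    then show ?thesis using seq_total[OF seqs] k succ_omega unfolding mem_branch[OF y] by metis
  qed
  show "i = j" if ij: "pair k i \<epsilon> branch K f y" "pair k j \<epsilon> branch K f y" for k i j
  proof -
    obtain n m where nm: "n \<epsilon> omega" "pair k i \<epsilon> scheme K f (restrict y n)"
      "m \<epsilon> omega" "pair k j \<epsilon> scheme K f (restrict y m)"
      using ij unfolding mem_branch[OF y] by blast
    \<comment> \<open>Both values are compared at a common later level, where the scheme is a single
      function.\<close>
    have "\<exists>l. l \<epsilon> omega \<and> subset n l \<and> subset m l"
      using omega_linear_subset[OF nm(1,3)] nm(1,3) subset_refl by blast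
    then obtain l where l: "l \<epsilon> omega" "subset n l" "subset m l" by blast
    have "pair k i \<epsilon> scheme K f (restrict y l)" "pair k j \<epsilon> scheme K f (restrict y l)"
      using nm l scheme_mono restrict_mono restrict_finseq[OF y] subsetD by meson+
    then show ?thesis using seq_unique[OF seqs[OF l(1)]] by blast
  qed
qed

text \<open>The key property of the scheme: nodes off the path of \<open>y\<close> are incompatible
  with its branch. Injectivity and both continuity proofs rest on it.\<close>

lemma scheme_subset_branch:
  assumes "t \<epsilon> finseq" "y \<epsilon> cantor"
  shows "subset (scheme K f t) (branch K f y) \<longleftrightarrow> subset t y"
proof
  assume "subset t y"
  then have "restrict y (dom t) = t" "dom t \<epsilon> omega" using restrict_eq assms finseq_dom by blast+
  then show "subset (scheme K f t) (branch K f y)"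
    unfolding subset_def mem_branch[OF assms(2)] by metis
next
  note y = assms(2)
  have up: "subset t y \<Longrightarrow> t \<epsilon> finseq \<Longrightarrow> subset (scheme K f t) (branch K f y)" for t
    using restrict_eq y finseq_dom unfolding subset_def[of "scheme K f _"] mem_branch[OF y] by metis
  have "subset (scheme K f t) (branch K f y) \<longrightarrow> subset t y"
    using assms(1)
  proof (induction t rule: finseq_induct)
    case def
    show ?case by (intro definable)
  next
    case empty
    show ?case by simp
  next
    case (snoc t i)
    let ?r = "next_node K f (dom t) (scheme K f t)"
    show ?case
    proof
      assume "subset (scheme K f (snoc t i)) (branch K f y)"
      then have i: "subset (snoc ?r i) (branch K f y)" using scheme_snoc snoc by simp
      then have "subset (scheme K f t) (branch K f y)"
        using scheme_next snoc snoc_superset subset_trans by metis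
      then have ty: "subset t y" using snoc by blast
      obtain j where j: "j \<epsilon> two" "pair (dom t) j \<epsilon> y"
        using seq_total y finseq_dom snoc(1) unfolding mem_cantor by blast
      have "subset (snoc t j) y" using ty j unfolding subset_def mem_snoc by blast
      then have "subset (snoc ?r j) (branch K f y)" using up scheme_snoc j snoc snoc_finseq by metis
      \<comment> \<open>At the position where the scheme branches, the branch of \<open>y\<close>
        holds the digit \<open>j\<close> of \<open>y\<close>; a node with digit \<open>i\<close>
        inside the same branch forces \<open>i = j\<close>.\<close>
      then have "pair (dom ?r) i \<epsilon> branch K f y" "pair (dom ?r) j \<epsilon> branch K f y"
        using i subsetD mem_snoc by blast+
      then have "i = j" using branch_cantor[OF y] seq_unique unfolding mem_cantor by blast
      then show "subset (snoc t i) y" using \<open>subset (snoc t j) y\<close> by simp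
    qed
  qed
  then show "subset (scheme K f t) (branch K f y) \<Longrightarrow> subset t y" by blast
qed

lemma branch_inj:
  assumes "x \<epsilon> cantor" "y \<epsilon> cantor" "branch K f x = branch K f y"
  shows "x = y"
proof (rule seq_ext)
  show "seq x omega" "seq y omega" using assms by simp_all
  fix k i assume k: "pair k i \<epsilon> x"
  then have "succ k \<epsilon> omega" using assms(1) seq_pairD succ_omega unfolding mem_cantor by blast
  then have "subset (restrict x (succ k)) y"
    using scheme_subset_branch[OF restrict_finseq[OF assms(1)]] assms restrict_subset by metis
  then show "pair k i \<epsilon> y" using k subsetD pair_mem_restrict mem_succ by metis
qed

text \<open>The scheme at level n has length at least n, so the first \<open>dom s\<close> digits of
  \<open>y\<close> already fix the part \<open>s\<close> of its branch.\<close>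

lemma subset_branch:
  assumes "s \<epsilon> finseq" "y \<epsilon> cantor" "subset s (branch K f y)"
  shows "subset s (scheme K f (restrict y (dom s)))"
proof -
  have r: "restrict y (dom s) \<epsilon> finseq" "dom (restrict y (dom s)) = dom s"
    using restrict_finseq dom_restrict finseq_dom assms by blast+
  have "subset (scheme K f (restrict y (dom s))) (branch K f y)"
    using scheme_subset_branch[OF r(1) assms(2)] restrict_subset by blast
  moreover have "subset (dom s) (dom (scheme K f (restrict y (dom s))))"
    using dom_scheme[OF r(1)] r(2) by simp
  ultimately show ?thesis
    using seq_subset_chain[OF finseq_seq[OF assms(1)] finseq_seq[OF scheme_finseq[OF r(1)]] _ assms(3)]
      branch_cantor[OF assms(2)] unfolding mem_cantor by blast
qed

lemma branch_mem:
  assumes y: "y \<epsilon> cantor" and n: "n \<epsilon> omega" "pair n U \<epsilon> f"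
  shows "branch K f y \<epsilon> U"
proof -
  let ?t = "restrict y n" let ?r = "next_node K f n (scheme K f ?t)"
  have t: "?t \<epsilon> finseq" "dom ?t = n" using restrict_finseq dom_restrict y n by blast+
  obtain j where j: "j \<epsilon> two" "pair n j \<epsilon> y" using seq_total y n(1) unfolding mem_cantor by blast
  \<comment> \<open>The open set of index \<open>n\<close> is entered between levels
    \<open>n\<close> and n + 1, so one further digit of \<open>y\<close> is used.\<close>
  have "subset (snoc ?t j) y" using j unfolding subset_def mem_snoc mem_restrict t(2) by blast
  then have "subset (snoc ?r j) (branch K f y)"
    using scheme_subset_branch[OF snoc_finseq[OF t(1) j(1)] y] scheme_snoc[OF t(1) j(1)] t(2) by simp
  then have "branch K f y \<epsilon> cylinder ?r"
    using branch_cantor[OF y] snoc_superset subset_trans unfolding mem_cylinder by blast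
  moreover have "subset (cylinder ?r) U" using next_node[OF scheme_good[OF t(1)]] n(2) node_def by blast
  ultimately show ?thesis using subsetD by blast
qed

text \<open>The perfect set is the range of \<open>branch\<close>; \<open>g\<close> is this map and
  \<open>h\<close> its inverse.\<close>

lemma ex_perfect:
  assumes A: "\<And>x. x \<epsilon> cantor \<Longrightarrow> (\<And>n U. n \<epsilon> omega \<Longrightarrow> pair n U \<epsilon> f \<Longrightarrow> x \<epsilon> U) \<Longrightarrow> x \<epsilon> A"
  shows "\<exists>P. perfect P \<and> subset P A"
proof -
  define P where "P = Sep cantor (\<lambda>x. \<exists>y. y \<epsilon> cantor \<and> x = branch K f y)"
  define g where "g = Sep (prod cantor P) (\<lambda>p. \<exists>y. p = pair y (branch K f y))"
  define h where "h = Sep (prod P cantor) (\<lambda>p. \<exists>y. p = pair (branch K f y) y)"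
  have "defP (\<lambda>v. \<exists>y. y \<epsilon> cantor \<and> v 0 = branch K f y)" by (intro definable)
  then have P: "x \<epsilon> P \<longleftrightarrow> (\<exists>y. y \<epsilon> cantor \<and> x = branch K f y)" for x
    unfolding P_def by (subst mem_Sep) (use branch_cantor in auto)
  have "defP (\<lambda>v. \<exists>y. v 0 = pair y (branch K f y))" by (intro definable)
  then have g: "p \<epsilon> g \<longleftrightarrow> (\<exists>y. y \<epsilon> cantor \<and> p = pair y (branch K f y))" for p
    unfolding g_def by (subst mem_Sep) (use P pair_mem_prod in blast)+
  have "defP (\<lambda>v. \<exists>y. v 0 = pair (branch K f y) y)" by (intro definable)
  then have h: "p \<epsilon> h \<longleftrightarrow> (\<exists>y. y \<epsilon> cantor \<and> p = pair (branch K f y) y)" for p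
    unfolding h_def by (subst mem_Sep) (use P pair_mem_prod in blast)+
  have func_g: "func g cantor P"
    by (rule seqI) (unfold g P pair_eq, blast+)
  have func_h: "func h P cantor"
    by (rule seqI) (unfold h P pair_eq, (blast | metis branch_inj)+)
  have "open_in cantor (set_of (\<lambda>x. x \<epsilon> cantor \<and> (\<exists>y. y \<epsilon> W \<and> pair x y \<epsilon> g)))" (is "open_in _ ?V")
    if W: "open_in P W" for W
  proof -
    obtain U where U: "is_open U" "W = inter P U" using W open_in_def by blast
    have "x \<epsilon> ?V \<longleftrightarrow> x \<epsilon> cantor \<and> (\<exists>y. y \<epsilon> W \<and> pair x y \<epsilon> g)" for x
      by (intro mem_set_of separation_definable definable)
    moreover have "(\<exists>y. y \<epsilon> W \<and> pair x y \<epsilon> g) \<longleftrightarrow> x \<epsilon> cantor \<and> branch K f x \<epsilon> U" for x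
      unfolding U(2) mem_inter P g pair_eq by auto
    ultimately have V: "x \<epsilon> ?V \<longleftrightarrow> x \<epsilon> cantor \<and> branch K f x \<epsilon> U" for x by blast
    have "is_open ?V"
      unfolding is_open_iff
    proof (intro conjI allI impI)
      show "subset ?V cantor" unfolding subset_def V by blast
      fix x assume "x \<epsilon> ?V"
      then have x: "x \<epsilon> cantor" "branch K f x \<epsilon> U" using V by blast+
      then obtain s where s: "s \<epsilon> finseq" "subset s (branch K f x)" "subset (cylinder s) U"
        using U(1) is_open_iff by blast
      \<comment> \<open>All points that share the first \<open>dom s\<close> digits of
        \<open>x\<close> have branches through \<open>s\<close>.\<close>
      let ?t = "restrict x (dom s)"
      have t: "?t \<epsilon> finseq" using restrict_finseq x s finseq_dom by blast
      have "subset (cylinder ?t) ?V"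
      proof (rule subsetI)
        fix z assume "z \<epsilon> cylinder ?t"
        then have z: "z \<epsilon> cantor" "subset ?t z" using mem_cylinder by blast+
        then have "subset s (branch K f z)"
          using scheme_subset_branch[OF t z(1)] subset_branch[OF s(1) x(1) s(2)] subset_trans by blast
        then show "z \<epsilon> ?V" unfolding V
          using z branch_cantor s(3) subsetD mem_cylinder by blast
      qed
      then show "\<exists>t. t \<epsilon> finseq \<and> subset t x \<and> subset (cylinder t) ?V"
        using t restrict_subset by blast
    qed
    moreover have "?V = inter cantor ?V" by (rule ext) (use V mem_inter in blast)
    ultimately show ?thesis unfolding open_in_def by blast
  qed
  then have g_cont: "continuous g cantor P" unfolding continuous_def using func_g by blast
  have "open_in P (set_of (\<lambda>x. x \<epsilon> P \<and> (\<exists>y. y \<epsilon> W \<and> pair x y \<epsilon> h)))" (is "open_in _ ?V")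
    if W: "open_in cantor W" for W
  proof -
    obtain U where U: "is_open U" "W = inter cantor U" using W open_in_def by blast
    have "x \<epsilon> ?V \<longleftrightarrow> x \<epsilon> P \<and> (\<exists>y. y \<epsilon> W \<and> pair x y \<epsilon> h)" for x
      by (intro mem_set_of separation_definable definable)
    moreover have "x \<epsilon> P \<and> (\<exists>y. y \<epsilon> W \<and> pair x y \<epsilon> h) \<longleftrightarrow>
        (\<exists>y. y \<epsilon> cantor \<and> y \<epsilon> U \<and> x = branch K f y)" for x
      unfolding U(2) mem_inter P h pair_eq by blast
    ultimately have V: "x \<epsilon> ?V \<longleftrightarrow> (\<exists>y. y \<epsilon> cantor \<and> y \<epsilon> U \<and> x = branch K f y)" for x by simp
    \<comment> \<open>Continuity of the inverse: \<open>E\<close> is the union of the cylinders of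
      those scheme nodes whose index \<open>t\<close> has its own cylinder inside \<open>U\<close>.
      It meets \<open>P\<close> exactly in the branches of the points of \<open>U\<close>.\<close>
    define E where "E = Sep cantor (\<lambda>x. \<exists>t. t \<epsilon> finseq \<and> subset (cylinder t) U \<and>
      subset (scheme K f t) x)"
    have "defP (\<lambda>v. \<exists>t. t \<epsilon> finseq \<and> subset (cylinder t) U \<and> subset (scheme K f t) (v 0))"
      by (intro definable)
    then have E: "x \<epsilon> E \<longleftrightarrow> x \<epsilon> cantor \<and> (\<exists>t. t \<epsilon> finseq \<and> subset (cylinder t) U \<and>
      subset (scheme K f t) x)" for x
      unfolding E_def by (subst mem_Sep) auto
    have "is_open E"
      unfolding is_open_iff
    proof (intro conjI allI impI)
      show "subset E cantor" unfolding subset_def E by blast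
      fix x assume "x \<epsilon> E"
      then obtain t where t: "t \<epsilon> finseq" "subset (cylinder t) U" "subset (scheme K f t) x"
        using E by blast
      then have "subset (cylinder (scheme K f t)) E"
        unfolding subset_def[of "cylinder (scheme K f t)"] E mem_cylinder by blast
      then show "\<exists>s. s \<epsilon> finseq \<and> subset s x \<and> subset (cylinder s) E" using t scheme_finseq by blast
    qed
    moreover have "?V = inter P E"
    proof (rule ext)
      have "branch K f y \<epsilon> E \<longleftrightarrow> y \<epsilon> U" if y: "y \<epsilon> cantor" for y
      proof -
        have "branch K f y \<epsilon> E \<longleftrightarrow> (\<exists>t. t \<epsilon> finseq \<and> subset (cylinder t) U \<and> subset t y)"
          unfolding E using scheme_subset_branch[OF _ y] branch_cantor[OF y] by blast
        also have "\<dots> \<longleftrightarrow> y \<epsilon> U"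
          using U(1) y is_open_iff subsetD mem_cylinder by blast
        finally show ?thesis .
      qed
      then show "x \<epsilon> ?V \<longleftrightarrow> x \<epsilon> inter P E" for x
        using V[of x] P[of x] mem_inter by blast
    qed
    ultimately show ?thesis unfolding open_in_def by blast
  qed
  then have h_cont: "continuous h P cantor" unfolding continuous_def using func_h by blast
  have "pair x y \<epsilon> h \<longleftrightarrow> pair y x \<epsilon> g" for x y unfolding g h pair_eq by blast
  then have "homeomorphic P cantor" unfolding homeomorphic_def using g_cont h_cont by blast
  moreover have "subset P cantor" unfolding subset_def P using branch_cantor by blast
  moreover have "subset P A" unfolding subset_def P using A branch_cantor branch_mem by blast
  ultimately show ?thesis unfolding perfect_def by blast
qed

end

lemma G_delta_perfect:
  assumes "G_delta G" "subset K G" "dense_in_itself K" "K \<noteq> empty"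
  shows "\<exists>P. perfect P \<and> subset P G"
proof -
  obtain F where F: "countable F" "\<And>U. U \<epsilon> F \<Longrightarrow> is_open U"
    "G = set_of (\<lambda>x. x \<epsilon> cantor \<and> (\<forall>U. U \<epsilon> F \<longrightarrow> x \<epsilon> U))"
    using assms(1) unfolding G_delta_def by blast
  have G: "x \<epsilon> G \<longleftrightarrow> x \<epsilon> cantor \<and> (\<forall>U. U \<epsilon> F \<longrightarrow> x \<epsilon> U)" for x
    unfolding F(3) by (intro mem_set_of separation_definable definable)
  \<comment> \<open>An empty \<open>F\<close> admits no map from \<open>omega\<close>, so
    \<open>f\<close> is allowed to be partial and is \<open>empty\<close> in that case.\<close>
  obtain f where f: "\<And>n U. pair n U \<epsilon> f \<Longrightarrow> U \<epsilon> F"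
    "\<And>n U V. pair n U \<epsilon> f \<Longrightarrow> pair n V \<epsilon> f \<Longrightarrow> U = V"
    "\<And>U. U \<epsilon> F \<Longrightarrow> \<exists>n. n \<epsilon> omega \<and> pair n U \<epsilon> f"
  proof (cases "F = empty")
    case True
    then show thesis using that[of empty] by simp
  next
    case False
    then obtain f where "func f omega F" "\<And>U. U \<epsilon> F \<Longrightarrow> \<exists>n. n \<epsilon> omega \<and> pair n U \<epsilon> f"
      using F(1) unfolding countable_def by blast
    then show thesis using that[of f] seq_pairD seq_unique by metis
  qed
  have K: "subset K cantor" using assms(2) G unfolding subset_def by blast
  have open_f: "is_open U \<and> subset K U" if "pair n U \<epsilon> f" for n U
    using f(1)[OF that] F(2) assms(2) G unfolding subset_def by blast
  show ?thesis
  proof (rule ex_perfect[OF K assms(3,4) open_f f(2)])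
    fix x assume x: "x \<epsilon> cantor" "\<And>n U. n \<epsilon> omega \<Longrightarrow> pair n U \<epsilon> f \<Longrightarrow> x \<epsilon> U"
    then show "x \<epsilon> G" using f(3) unfolding G by blast
  qed
qed

lemma G_delta_sigma_countable_or_perfect:
  assumes "G_delta_sigma A"
  shows "countable A \<or> (\<exists>P. perfect P \<and> subset P A)"
proof -
  obtain F where F: "countable F" "\<And>G. G \<epsilon> F \<Longrightarrow> G_delta G" "A = big_union F"
    using assms unfolding G_delta_sigma_def by blast
  show ?thesis
  proof (cases "\<exists>G K. G \<epsilon> F \<and> subset K G \<and> dense_in_itself K \<and> K \<noteq> empty")
    case True
    then obtain G P where "G \<epsilon> F" "perfect P" "subset P G" using G_delta_perfect F(2) by blast
    then show ?thesis unfolding F(3) subset_def mem_big_union by blast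
  next
    case False
    then show ?thesis using countable_union_scattered[OF F(1)] unfolding F(3) by blast
  qed
qed

end

theorem theorem1p2:
  fixes mem :: "'a \<Rightarrow> 'a \<Rightarrow> bool" and A :: 'a
  assumes "ZF mem"
    and "membership.subset mem A (membership.cantor mem)"
    and "membership.G_delta_sigma mem A"
  shows "membership.countable mem A \<or>
    (\<exists>P. membership.perfect mem P \<and> membership.subset mem P A)"
  by (rule ZF.G_delta_sigma_countable_or_perfect[OF assms(1,3)])

end
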